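(* Let $T$ be a spider of order $n$. Let $m=\lfloor n/2\rfloor$, let $d_a=|c_{(n-a,a)}(T)|$ for $1\leq a\leq m$, and let $d(T)=(d_1,\dots,d_m)$. Then one of the following holds: (1) $d_1\geq d_2\geq\cdots\geq d_m\geq 0$ (so $d(T)$ is a partition, ignoring zero entries); (2) there is a number $t\leq m$ such that $d_1\geq\cdots\geq d_t=1$, and moreover $d_{t+1}=d_{t+2}=\cdots=d_{m-1}=2$ and $d_m\in\{1,2\}$. In case (1) let $\mu=d(T)$; in case (2) let $\mu$ be the partition obtained from $d(T)$ by replacing every entry $2$ after the $t$-th place by two entries $1$. Then $T=T_\lambda$ (up to isomorphism), where $\lambda$ is the conjugate partition of $\mu$.
   Context: A spider is a tree with exactly one vertex of degree $\geq 3$; it consists of edge-disjoint paths (legs) with a common endpoint. For a partition $\lambda\vdash n-1$ with at least 3 parts, $T_\lambda$ denotes the spider on $n$ vertices whose leg lengths (numbers of edges) are the parts of $\lambda$. For a graph $G$, ${\mathbf X}_G=\sum_\kappa\prod_{v}x_{\kappa(v)}$ over all proper colorings $\kappa:V(G)\to\{1,2,\dots\}$, and $c_\nu(G)$ denotes the coefficient of the power-sum symmetric function $p_\nu=\prod_j p_{\nu_j}$ (with $p_k=\sum_i x_i^k$) in ${\mathbf X}_G$; here $(n-a,a)$ is the two-part partition of $n$ with parts $n-a$ and $a$. The conjugate of a partition $\mu$ is the partition whose $i$-th part is $\#\{j : \mu_j\geq i\}$. *)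

theory Defs
  imports Complex_Main "HOL-Library.Multiset" "HOL-Library.FuncSet"
begin

text \<open>
  A finite simple graph is given by its vertex set \<open>V\<close> and its set \<open>E\<close> of two-element
  edges. (The predicates for forests and trees in the AFP entry on graph theory are about
  directed cycles, so that a symmetric digraph with an edge is never a tree.)
\<close>

definition simple_graph :: "'a set \<Rightarrow> 'a set set \<Rightarrow> bool" where
  "simple_graph V E \<longleftrightarrow> finite V \<and> (\<forall>e\<in>E. e \<subseteq> V \<and> card e = 2)"

definition connected_graph :: "'a set \<Rightarrow> 'a set set \<Rightarrow> bool" where
  "connected_graph V E \<longleftrightarrow>
     V \<noteq> {} \<and> (\<forall>u\<in>V. \<forall>v\<in>V. (u, v) \<in> {(x, y). {x, y} \<in> E}\<^sup>*)"

definition graph_cycle :: "'a set set \<Rightarrow> 'a list \<Rightarrow> bool" where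
  "graph_cycle E vs \<longleftrightarrow> 3 \<le> length vs \<and> distinct vs \<and>
     (\<forall>i<length vs. {vs ! i, vs ! (Suc i mod length vs)} \<in> E)"

definition tree_graph :: "'a set \<Rightarrow> 'a set set \<Rightarrow> bool" where
  "tree_graph V E \<longleftrightarrow> simple_graph V E \<and> connected_graph V E \<and> (\<nexists>vs. graph_cycle E vs)"

definition degree :: "'a set set \<Rightarrow> 'a \<Rightarrow> nat" where
  "degree E v = card {e \<in> E. v \<in> e}"

definition spider :: "'a set \<Rightarrow> 'a set set \<Rightarrow> bool" where
  "spider V E \<longleftrightarrow> tree_graph V E \<and> (\<exists>!v. v \<in> V \<and> 3 \<le> degree E v)"

definition graph_iso :: "'a set \<Rightarrow> 'a set set \<Rightarrow> 'b set \<Rightarrow> 'b set set \<Rightarrow> bool" where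
  "graph_iso V E W F \<longleftrightarrow>
     (\<exists>f. bij_betw f V W \<and> (\<forall>u\<in>V. \<forall>v\<in>V. {u, v} \<in> E \<longleftrightarrow> {f u, f v} \<in> F))"

definition partition_of :: "nat \<Rightarrow> nat list \<Rightarrow> bool" where
  "partition_of n \<nu> \<longleftrightarrow> sorted_wrt (\<ge>) \<nu> \<and> (\<forall>k\<in>set \<nu>. 0 < k) \<and> sum_list \<nu> = n"

definition conj_partition :: "nat list \<Rightarrow> nat list" where
  "conj_partition \<mu> =
     map (\<lambda>i. card {j. j < length \<mu> \<and> i \<le> \<mu> ! j}) [1..<Suc (Max (insert 0 (set \<mu>)))]"

text \<open>
  The \<open>j\<close>-th vertex on the \<open>i\<close>-th leg, counted from the centre; position 0 on every leg
  is the centre \<open>(0, 0)\<close>.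
\<close>

definition leg_vertex :: "nat \<Rightarrow> nat \<Rightarrow> nat \<times> nat" where
  "leg_vertex i j = (if j = 0 then (0, 0) else (i, j))"

definition spider_verts :: "nat list \<Rightarrow> (nat \<times> nat) set" where
  "spider_verts lam = insert (0, 0) {leg_vertex i j | i j. i < length lam \<and> j \<le> lam ! i}"

definition spider_edges :: "nat list \<Rightarrow> (nat \<times> nat) set set" where
  "spider_edges lam =
     {{leg_vertex i j, leg_vertex i (Suc j)} | i j. i < length lam \<and> j < lam ! i}"

definition is_spider_T :: "nat list \<Rightarrow> 'a set \<Rightarrow> 'a set set \<Rightarrow> bool" where
  "is_spider_T lam V E \<longleftrightarrow> partition_of (card V - 1) lam \<and> 3 \<le> length lam \<and>
     graph_iso V E (spider_verts lam) (spider_edges lam)"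

text \<open>
  Formal power series over the rationals in the variables \<open>x\<^sub>1, x\<^sub>2, \<dots>\<close>, as functions sending a
  monomial to its coefficient. A monomial is the multiset of the indices of its variables.
\<close>

type_synonym series = "nat multiset \<Rightarrow> rat"

definition series_one :: series where
  "series_one \<alpha> = (if \<alpha> = {#} then 1 else 0)"

definition series_mult :: "series \<Rightarrow> series \<Rightarrow> series" where
  "series_mult f g \<alpha> = (\<Sum>\<beta>\<in>{\<beta>. \<beta> \<subseteq># \<alpha>}. f \<beta> * g (\<alpha> - \<beta>))"

text \<open>
  The coefficients of \<open>p\<^sub>k = \<Sum>i. x\<^sub>i\<^sup>k\<close>, for \<open>k\<close> positive.
\<close>

definition power_sum :: "nat \<Rightarrow> series" where
  "power_sum k \<alpha> = (if \<exists>i\<ge>1. \<alpha> = replicate_mset k i then 1 else 0)"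

definition power_sum_partition :: "nat list \<Rightarrow> series" where
  "power_sum_partition \<nu> = foldr series_mult (map power_sum \<nu>) series_one"

definition proper_coloring :: "'a set \<Rightarrow> 'a set set \<Rightarrow> ('a \<Rightarrow> nat) \<Rightarrow> bool" where
  "proper_coloring V E \<kappa> \<longleftrightarrow> \<kappa> \<in> V \<rightarrow>\<^sub>E {1..} \<and> (\<forall>u v. {u, v} \<in> E \<longrightarrow> \<kappa> u \<noteq> \<kappa> v)"

definition chromatic_sym :: "'a set \<Rightarrow> 'a set set \<Rightarrow> series" where
  "chromatic_sym V E \<alpha> =
     of_nat (card {\<kappa>. proper_coloring V E \<kappa> \<and> image_mset \<kappa> (mset_set V) = \<alpha>})"

text \<open>
  The chromatic symmetric function is homogeneous of degree \<open>card V\<close>, so its expansion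
  involves only the \<open>p\<^sub>\<nu>\<close> with \<open>\<nu>\<close> a partition of \<open>card V\<close>.
\<close>

definition power_sum_coeff :: "'a set \<Rightarrow> 'a set set \<Rightarrow> nat list \<Rightarrow> rat" where
  "power_sum_coeff V E =
     (THE c. (\<forall>\<nu>. \<not> partition_of (card V) \<nu> \<longrightarrow> c \<nu> = 0) \<and>
        (\<forall>\<alpha>. chromatic_sym V E \<alpha> =
           (\<Sum>\<nu> | partition_of (card V) \<nu>. c \<nu> * power_sum_partition \<nu> \<alpha>)))"

end

theory Submission
  imports Defs "HOL-Combinatorics.List_Permutation"
begin

text \<open>
  Inclusion-exclusion over monochromatic edges gives
  \<open>X\<^sub>G = \<Sum>S\<subseteq>E. (-1)\<^bsup>|S|\<^esup> p\<^bsub>type S\<^esub>\<close>, where \<open>type S\<close> lists the component sizes of \<open>(V, S)\<close>, and the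
  \<open>p\<^sub>\<nu>\<close> are linearly independent. For a spider, \<open>S\<close> has exactly two components iff it misses
  exactly one edge, and the edge that cuts off the last \<open>s\<close> vertices of a leg leaves components of
  sizes \<open>s\<close> and \<open>n - s\<close>. So \<open>d\<^sub>a\<close> is the number of legs of length at least \<open>a\<close>, plus, when
  \<open>2a \<noteq> n\<close>, the number of legs of length at least \<open>n - a\<close>. The second summand vanishes throughout
  when no leg is longer than \<open>n div 2\<close>, and then \<open>d\<close> is the conjugate of \<open>\<lambda>\<close>. Otherwise the longest
  leg, of length \<open>L\<close>, is the only one of length at least \<open>t = n - 1 - L\<close>, and each entry \<open>2\<close> after place \<open>t\<close> merges
  two entries \<open>1\<close> of the conjugate partition.
\<close>

section \<open>Linear independence of power sums\<close>

text \<open>\<open>power_sum_coeff\<close> is a definite description, so no coefficient can be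
  evaluated before the expansion is known to exist and to be unique; this is where linear
  independence enters. The counting takes place in the coordinate model
  \<open>spider_verts lam\<close>, whereas a spider is given only by connectedness, absence of
  cycles and vertex degrees. This gap is the main graph-theoretic obstacle: an induced copy of a
  model spider is grown inside the tree, vertex by vertex, until it exhausts the tree. The constant
  t = n - 1 - L is the total length of the legs other than the longest. Since (t + 1) + L = n, the
  map from a to n - a preserves the interval from t + 1 to L. Folding the interval at n / 2 produces
  the entries 2, and for even n the fixed point n / 2 produces a last entry 1. The two cases of the
  statement can overlap: if L \<le> m, then case (1) holds and case (2) may hold as well. Both
  recipes then have to yield the same partition, and they do because no entry after place t is a
  2.\<close>

definition monomial_of :: "nat list \<Rightarrow> nat list \<Rightarrow> nat multiset" where
  "monomial_of \<nu> xs = sum_list (map2 replicate_mset \<nu> xs)"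

lemma monomial_of_simps [simp]:
  "monomial_of [] [] = {#}"
  "monomial_of (k # \<nu>) (i # xs) = replicate_mset k i + monomial_of \<nu> xs"
  by (simp_all add: monomial_of_def)

lemma set_mset_monomial_of:
  assumes "length xs = length \<nu>"
  shows "set_mset (monomial_of \<nu> xs) \<subseteq> set xs"
  using assms[symmetric] by (induction rule: list_induct2) auto

lemma set_mset_monomial_of_eq:
  assumes "length xs = length \<nu>" "\<forall>k\<in>set \<nu>. 0 < k"
  shows "set_mset (monomial_of \<nu> xs) = set xs"
  using assms(1)[symmetric] assms(2)
  by (induction rule: list_induct2) (auto split: if_splits)

lemma map_count_monomial_of:
  assumes "length xs = length \<nu>" "distinct xs"
  shows "map (count (monomial_of \<nu> xs)) xs = \<nu>"
  using assms(1)[symmetric] assms(2)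
proof (induction rule: list_induct2)
  case (Cons k \<nu> i xs)
  have "i \<notin># monomial_of \<nu> xs"
    using set_mset_monomial_of[of xs \<nu>] Cons by auto
  moreover have "map (\<lambda>a. (if a = i then k else 0) + count (monomial_of \<nu> xs) a) xs = \<nu>"
  proof -
    have "map (\<lambda>a. (if a = i then k else 0) + count (monomial_of \<nu> xs) a) xs
        = map (count (monomial_of \<nu> xs)) xs"
      using Cons.prems by (intro map_cong) auto
    also have "\<dots> = \<nu>" using Cons by simp
    finally show ?thesis .
  qed
  ultimately show ?case by (simp add: not_in_iff)
qed simp

text \<open>Distinct variables keep the exponents from merging, so the multiset of nonzero exponents
  of \<alpha>, which forgets the names of the variables, is the multiset of parts of \<nu>.\<close>

lemma mset_eq_counts_monomial_of:
  assumes "length xs = length \<nu>" "distinct xs" "\<forall>k\<in>set \<nu>. 0 < k"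
    and "\<alpha> = monomial_of \<nu> xs"
  shows "image_mset (count \<alpha>) (mset_set (set_mset \<alpha>)) = mset \<nu>"
proof -
  have "mset_set (set_mset \<alpha>) = mset xs"
    using assms by (simp add: set_mset_monomial_of_eq mset_set_set)
  then have "image_mset (count \<alpha>) (mset_set (set_mset \<alpha>)) = mset (map (count \<alpha>) xs)"
    by simp
  then show ?thesis using assms by (simp add: map_count_monomial_of)
qed

lemma power_sum_partition_simps [simp]:
  "power_sum_partition [] = series_one"
  "power_sum_partition (k # \<nu>) = series_mult (power_sum k) (power_sum_partition \<nu>)"
  by (simp_all add: power_sum_partition_def)

text \<open>This is the index set of the convolution in \<open>series_mult\<close>. Finiteness
  matters because \<open>sum\<close> is 0 on infinite sets.\<close>

lemma finite_submultisets: "finite {\<beta>. \<beta> \<subseteq># (\<alpha> :: 'b multiset)}"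
proof -
  have "{\<beta>. \<beta> \<subseteq># \<alpha>} \<subseteq> mset ` {xs. set xs \<subseteq> set_mset \<alpha> \<and> length xs \<le> size \<alpha>}"
  proof
    fix \<beta> assume "\<beta> \<in> {\<beta>. \<beta> \<subseteq># \<alpha>}"
    moreover obtain xs where "mset xs = \<beta>" using ex_mset by blast
    ultimately show "\<beta> \<in> mset ` {xs. set xs \<subseteq> set_mset \<alpha> \<and> length xs \<le> size \<alpha>}"
      by (force dest: set_mset_mono size_mset_mono)
  qed
  then show ?thesis using finite_lists_length_le[OF finite_set_mset] finite_surj by blast
qed

lemma power_sum_partition_nonneg: "0 \<le> power_sum_partition \<nu> \<alpha>"
proof (induction \<nu> arbitrary: \<alpha>)
  case (Cons k \<nu>)
  then show ?case by (auto simp: series_mult_def power_sum_def intro!: sum_nonneg)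
qed (simp add: series_one_def)

text \<open>A nonzero convolution has a nonzero summand, so every factor contributes a power of a
  single variable. Entries of \<open>xs\<close> may coincide, and then the exponents add up.\<close>

lemma power_sum_partition_support:
  "power_sum_partition \<nu> \<alpha> \<noteq> 0 \<Longrightarrow> \<exists>xs. length xs = length \<nu> \<and> \<alpha> = monomial_of \<nu> xs"
proof (induction \<nu> arbitrary: \<alpha>)
  case Nil
  then show ?case by (auto simp: series_one_def split: if_splits)
next
  case (Cons k \<nu>)
  then obtain \<beta> where \<beta>: "\<beta> \<subseteq># \<alpha>" "power_sum k \<beta> * power_sum_partition \<nu> (\<alpha> - \<beta>) \<noteq> 0"
    by (auto simp: series_mult_def elim: sum.not_neutral_contains_not_neutral)
  then obtain i where i: "\<beta> = replicate_mset k i" by (auto simp: power_sum_def split: if_splits)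
  from \<beta> Cons.IH[of "\<alpha> - \<beta>"] obtain xs where
    "length xs = length \<nu>" "\<alpha> - \<beta> = monomial_of \<nu> xs" by auto
  then have "length (i # xs) = length (k # \<nu>) \<and> \<alpha> = monomial_of (k # \<nu>) (i # xs)"
    using \<beta>(1) i by (metis length_Cons monomial_of_simps(2) subset_mset.add_diff_inverse)
  then show ?case by blast
qed

text \<open>All coefficients are nonnegative, so nothing cancels and one positive summand suffices:
  the one that takes the power of variable \<open>i\<close> from the first factor.\<close>

lemma power_sum_partition_monomial_of_pos:
  assumes "length xs = length \<nu>" "\<forall>i\<in>set xs. 1 \<le> i"
  shows "0 < power_sum_partition \<nu> (monomial_of \<nu> xs)"
  using assms(1)[symmetric] assms(2)
proof (induction rule: list_induct2)
  case (Cons k \<nu> i xs)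
  let ?\<alpha> = "replicate_mset k i + monomial_of \<nu> xs"
  let ?g = "\<lambda>\<beta>. power_sum k \<beta> * power_sum_partition \<nu> (?\<alpha> - \<beta>)"
  have "0 < ?g (replicate_mset k i)"
    using Cons by (auto simp: power_sum_def)
  also have "?g (replicate_mset k i) \<le> sum ?g {\<beta>. \<beta> \<subseteq># ?\<alpha>}"
    by (rule member_le_sum)
      (auto simp: finite_submultisets power_sum_def power_sum_partition_nonneg)
  finally show ?case by (simp add: series_mult_def)
qed (simp add: series_one_def)

lemma finite_partitions: "finite {\<nu>. partition_of n \<nu>}"
proof (rule finite_subset)
  have "length \<nu> \<le> sum_list \<nu>" if "\<forall>k\<in>set \<nu>. 0 < k" for \<nu> :: "nat list"
    using that by (induction \<nu>) (auto simp: Suc_le_eq)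
  then show "{\<nu>. partition_of n \<nu>} \<subseteq> {\<nu>. set \<nu> \<subseteq> {..n} \<and> length \<nu> \<le> n}"
    by (auto simp: partition_of_def member_le_sum_list)
  show "finite {\<nu>. set \<nu> \<subseteq> {..n} \<and> length \<nu> \<le> n}"
    by (rule finite_lists_length_le) simp
qed

lemma partition_of_eqI:
  assumes "partition_of m \<mu>" "partition_of n \<nu>" "mset \<mu> = mset \<nu>"
  shows "\<mu> = \<nu>"
proof -
  have "sorted (rev \<mu>)" "sorted (rev \<nu>)" "mset (rev \<mu>) = mset (rev \<nu>)"
    using assms by (auto simp: partition_of_def sorted_wrt_rev)
  then have "rev \<mu> = rev \<nu>" by (metis properties_for_sort)
  then show ?thesis by simp
qed

text \<open>
  The coefficient of \<open>p\<^sub>\<nu>\<close> at a monomial with exponents \<open>\<mu>\<close> vanishes unless \<open>\<nu>\<close> refines \<open>\<mu>\<close>;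
  so testing at a \<open>\<mu>\<close> of maximal length in the support isolates one term.
\<close>

lemma power_sum_partition_independent:
  assumes "\<And>\<alpha>. (\<Sum>\<nu> | partition_of n \<nu>. c \<nu> * power_sum_partition \<nu> \<alpha>) = 0"
    and "partition_of n \<nu>"
  shows "c \<nu> = 0"
proof (rule ccontr)
  assume "c \<nu> \<noteq> 0"
  let ?C = "{\<nu>. partition_of n \<nu> \<and> c \<nu> \<noteq> 0}"
  have "finite ?C" by (rule finite_subset[OF _ finite_partitions]) auto
  moreover have "?C \<noteq> {}" using \<open>c \<nu> \<noteq> 0\<close> assms(2) by blast
  ultimately obtain \<mu> where \<mu>: "\<mu> \<in> ?C" and max: "\<And>\<nu>. \<nu> \<in> ?C \<Longrightarrow> length \<nu> \<le> length \<mu>"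
    using obtains_MAX[of ?C length] Max_ge[of "length ` ?C"] by (metis (no_types, lifting) finite_imageI imageI)
  \<comment> \<open>Distinct indices, beginning with 1 as the variables do: each part of \<mu>
    becomes the exponent of its own variable.\<close>
  define ys where "ys = [1..<Suc (length \<mu>)]"
  have ys: "length ys = length \<mu>" "distinct ys" "\<forall>i\<in>set ys. 1 \<le> i" by (auto simp: ys_def simp del: upt_Suc)
  define \<alpha> where "\<alpha> = monomial_of \<mu> ys"
  have pos: "\<forall>k\<in>set \<mu>. 0 < k" using \<mu> by (simp add: partition_of_def)
  have zero: "c \<nu> * power_sum_partition \<nu> \<alpha> = 0" if \<nu>: "partition_of n \<nu>" "\<nu> \<noteq> \<mu>" for \<nu>
  proof (rule ccontr)
    assume *: "c \<nu> * power_sum_partition \<nu> \<alpha> \<noteq> 0"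
    then obtain xs where xs: "length xs = length \<nu>" "\<alpha> = monomial_of \<nu> xs"
      using power_sum_partition_support by fastforce
    have pos': "\<forall>k\<in>set \<nu>. 0 < k" using \<nu> by (simp add: partition_of_def)
    have "set xs = set ys"
      using set_mset_monomial_of_eq[OF xs(1) pos'] set_mset_monomial_of_eq[OF ys(1) pos] xs(2)
      by (simp add: \<alpha>_def)
    \<comment> \<open>By maximality of \<mu>, the list \<open>xs\<close> is no longer than the
      distinct list \<open>ys\<close>. Having the same set of entries, it must be distinct
      too.\<close>
    moreover have "length xs \<le> length ys" using max[of \<nu>] * \<nu> xs ys by auto
    ultimately have "distinct xs"
      using ys by (metis card_distinct card_length distinct_card le_antisym)
    then have "mset \<nu> = mset \<mu>"
      using mset_eq_counts_monomial_of[OF xs(1) _ pos' xs(2)]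
        mset_eq_counts_monomial_of[OF ys(1,2) pos \<alpha>_def] by simp
    then show False using partition_of_eqI \<nu> \<mu> by blast
  qed
  have "(\<Sum>\<nu> | partition_of n \<nu>. c \<nu> * power_sum_partition \<nu> \<alpha>)
      = (\<Sum>\<nu>\<in>{\<mu>}. c \<nu> * power_sum_partition \<nu> \<alpha>)"
    using \<mu> zero by (intro sum.mono_neutral_right finite_partitions) auto
  then have "c \<mu> * power_sum_partition \<mu> \<alpha> = 0" using assms(1) by simp
  then show False
    using \<mu> power_sum_partition_monomial_of_pos[OF ys(1,3)] by (simp add: \<alpha>_def)
qed

section \<open>Colourings constant on blocks\<close>

lemma image_mset_replicate_iff:
  assumes "finite C"
  shows "image_mset \<kappa> (mset_set C) = replicate_mset (card C) i \<longleftrightarrow> (\<forall>v\<in>C. \<kappa> v = i)"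
proof
  assume "image_mset \<kappa> (mset_set C) = replicate_mset (card C) i"
  then have "set_mset (image_mset \<kappa> (mset_set C)) \<subseteq> {i}" by (metis set_mset_replicate_mset_subset subsetI singletonI empty_iff)
  then show "\<forall>v\<in>C. \<kappa> v = i" using assms by auto
next
  assume "\<forall>v\<in>C. \<kappa> v = i"
  then have "image_mset \<kappa> (mset_set C) = image_mset (\<lambda>_. i) (mset_set C)"
    using assms by (intro image_mset_cong) auto
  then show "image_mset \<kappa> (mset_set C) = replicate_mset (card C) i"
    by (simp add: image_mset_const_eq)
qed

definition block_colorings :: "'a set list \<Rightarrow> nat multiset \<Rightarrow> ('a \<Rightarrow> nat) set" where
  "block_colorings Cs \<alpha> =
     {\<kappa> \<in> \<Union>(set Cs) \<rightarrow>\<^sub>E {1..}. (\<forall>C\<in>set Cs. \<forall>u\<in>C. \<forall>v\<in>C. \<kappa> u = \<kappa> v) \<and>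
        image_mset \<kappa> (mset_set (\<Union>(set Cs))) = \<alpha>}"

text \<open>The set of colours is infinite, but a prescribed monomial confines a colouring to the
  variables that occur in it.\<close>

lemma finite_colorings:
  assumes "finite V"
  shows "finite {\<kappa> \<in> V \<rightarrow>\<^sub>E {1..}. image_mset \<kappa> (mset_set V) = (\<alpha> :: nat multiset)}"
proof (rule finite_subset)
  show "{\<kappa> \<in> V \<rightarrow>\<^sub>E {1..}. image_mset \<kappa> (mset_set V) = \<alpha>} \<subseteq> V \<rightarrow>\<^sub>E set_mset \<alpha>"
    using assms by (auto simp: PiE_def)
  show "finite (V \<rightarrow>\<^sub>E set_mset \<alpha>)" using assms by (intro finite_PiE) auto
qed

text \<open>Once the colour of the first block is fixed, restriction to the other blocks is a
  bijection, with inverse \<open>?ext\<close> painting \<open>C\<close> with \<open>i\<close>. The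
  colour \<open>i\<close> may recur on other blocks, so only its \<open>card C\<close> occurrences
  in \<open>C\<close> are removed from \<alpha>.\<close>

lemma card_block_colorings_Cons:
  fixes Cs :: "'a set list"
  assumes C: "finite C" "C \<noteq> {}" and fin: "finite (\<Union>(set Cs))" and disj: "C \<inter> \<Union>(set Cs) = {}"
    and i: "1 \<le> i" and sub: "replicate_mset (card C) i \<subseteq># \<alpha>"
  shows "card {\<kappa> \<in> block_colorings (C # Cs) \<alpha>. image_mset \<kappa> (mset_set C) = replicate_mset (card C) i}
       = card (block_colorings Cs (\<alpha> - replicate_mset (card C) i))"
    (is "card ?A = card ?B")
proof (rule bij_betw_same_card)
  define U where "U = \<Union>(set Cs)"
  have U: "finite U" "C \<inter> U = {}" "\<And>D. D \<in> set Cs \<Longrightarrow> D \<subseteq> U"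
    using fin disj by (auto simp: U_def)
  have A: "\<kappa> \<in> ?A \<longleftrightarrow> \<kappa> \<in> (C \<union> U) \<rightarrow>\<^sub>E {1..} \<and> (\<forall>D\<in>set Cs. \<forall>u\<in>D. \<forall>v\<in>D. \<kappa> u = \<kappa> v) \<and>
      (\<forall>v\<in>C. \<kappa> v = i) \<and> replicate_mset (card C) i + image_mset \<kappa> (mset_set U) = \<alpha>" for \<kappa>
  proof -
    have "image_mset \<kappa> (mset_set (C \<union> U)) = image_mset \<kappa> (mset_set C) + image_mset \<kappa> (mset_set U)"
      using U C by (simp add: mset_set_Union)
    moreover have "\<Union>(set (C # Cs)) = C \<union> U" by (simp add: U_def)
    ultimately have "\<kappa> \<in> ?A \<longleftrightarrow> \<kappa> \<in> (C \<union> U) \<rightarrow>\<^sub>E {1..} \<and>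
        (\<forall>u\<in>C. \<forall>v\<in>C. \<kappa> u = \<kappa> v) \<and> (\<forall>D\<in>set Cs. \<forall>u\<in>D. \<forall>v\<in>D. \<kappa> u = \<kappa> v) \<and>
        image_mset \<kappa> (mset_set C) + image_mset \<kappa> (mset_set U) = \<alpha> \<and> (\<forall>v\<in>C. \<kappa> v = i)"
      unfolding block_colorings_def mem_Collect_eq list.set ball_simps
        image_mset_replicate_iff[OF C(1), of \<kappa> i] by (simp only: conj_assoc)
    also have "\<dots> \<longleftrightarrow> \<kappa> \<in> (C \<union> U) \<rightarrow>\<^sub>E {1..} \<and> (\<forall>D\<in>set Cs. \<forall>u\<in>D. \<forall>v\<in>D. \<kappa> u = \<kappa> v) \<and>
      (\<forall>v\<in>C. \<kappa> v = i) \<and> replicate_mset (card C) i + image_mset \<kappa> (mset_set U) = \<alpha>"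
    proof (cases "\<forall>v\<in>C. \<kappa> v = i")
      case True
      then have eq: "image_mset \<kappa> (mset_set C) = replicate_mset (card C) i"
        by (rule iffD2[OF image_mset_replicate_iff[OF C(1)]])
      have "\<forall>u\<in>C. \<forall>v\<in>C. \<kappa> u = \<kappa> v" using True by simp
      with True show ?thesis unfolding eq by blast
    qed blast
    finally show ?thesis .
  qed
  have B: "\<kappa> \<in> ?B \<longleftrightarrow> \<kappa> \<in> U \<rightarrow>\<^sub>E {1..} \<and> (\<forall>D\<in>set Cs. \<forall>u\<in>D. \<forall>v\<in>D. \<kappa> u = \<kappa> v) \<and>
      replicate_mset (card C) i + image_mset \<kappa> (mset_set U) = \<alpha>" for \<kappa>
  proof -
    have "image_mset \<kappa> (mset_set U) = \<alpha> - replicate_mset (card C) i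
        \<longleftrightarrow> replicate_mset (card C) i + image_mset \<kappa> (mset_set U) = \<alpha>"
    proof
      assume "image_mset \<kappa> (mset_set U) = \<alpha> - replicate_mset (card C) i"
      then show "replicate_mset (card C) i + image_mset \<kappa> (mset_set U) = \<alpha>"
        using subset_mset.add_diff_inverse[OF sub] by (simp only:)
    next
      assume "replicate_mset (card C) i + image_mset \<kappa> (mset_set U) = \<alpha>"
      then show "image_mset \<kappa> (mset_set U) = \<alpha> - replicate_mset (card C) i"
        using add_diff_cancel_left' by metis
    qed
    then show ?thesis unfolding block_colorings_def U_def[symmetric] by blast
  qed
  let ?ext = "\<lambda>\<kappa> v. if v \<in> C then i else \<kappa> v"
  have image_ext: "image_mset (?ext \<kappa>) (mset_set U) = image_mset \<kappa> (mset_set U)" for \<kappa>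
    using U(1,2) by (intro image_mset_cong) auto
  have image_res: "image_mset (restrict \<kappa> U) (mset_set U) = image_mset \<kappa> (mset_set U)" for \<kappa> :: "'a \<Rightarrow> nat"
    using U(1) by (intro image_mset_cong) auto
  show "bij_betw (\<lambda>\<kappa>. restrict \<kappa> U) ?A ?B"
  proof (rule bij_betw_byWitness[where f' = ?ext])
    show "\<forall>\<kappa>\<in>?A. ?ext (restrict \<kappa> U) = \<kappa>"
    proof (intro ballI ext)
      fix \<kappa> v assume \<kappa>: "\<kappa> \<in> ?A"
      have "\<kappa> v = undefined" if "v \<notin> C \<union> U"
        using \<kappa>[unfolded A] that PiE_arb by fastforce
      then show "?ext (restrict \<kappa> U) v = \<kappa> v" using \<kappa>[unfolded A] by auto
    qed
    show "\<forall>\<kappa>\<in>?B. restrict (?ext \<kappa>) U = \<kappa>"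
    proof (intro ballI ext)
      fix \<kappa> v assume \<kappa>: "\<kappa> \<in> ?B"
      have "\<kappa> v = undefined" if "v \<notin> U" using \<kappa>[unfolded B] that PiE_arb by fastforce
      then show "restrict (?ext \<kappa>) U v = \<kappa> v" using U(2) by auto
    qed
    show "(\<lambda>\<kappa>. restrict \<kappa> U) ` ?A \<subseteq> ?B"
    proof (rule image_subsetI)
      fix \<kappa> assume \<kappa>: "\<kappa> \<in> ?A"
      have "restrict \<kappa> U \<in> U \<rightarrow>\<^sub>E {1..}" using \<kappa>[unfolded A] by fastforce
      moreover have "\<forall>D\<in>set Cs. \<forall>u\<in>D. \<forall>v\<in>D. restrict \<kappa> U u = restrict \<kappa> U v"
        using \<kappa>[unfolded A] U(3) by (metis restrict_apply' subsetD)
      ultimately show "restrict \<kappa> U \<in> ?B" using \<kappa>[unfolded A] unfolding B image_res by blast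
    qed
    show "?ext ` ?B \<subseteq> ?A"
    proof (rule image_subsetI)
      fix \<kappa> assume \<kappa>: "\<kappa> \<in> ?B"
      have "?ext \<kappa> \<in> (C \<union> U) \<rightarrow>\<^sub>E {1..}"
        using \<kappa>[unfolded B, THEN conjunct1] i by (auto simp: PiE_def Pi_def extensional_def)
      moreover have "\<forall>D\<in>set Cs. \<forall>u\<in>D. \<forall>v\<in>D. ?ext \<kappa> u = ?ext \<kappa> v"
      proof (intro ballI)
        fix D u v assume D: "D \<in> set Cs" "u \<in> D" "v \<in> D"
        then have "u \<notin> C" "v \<notin> C" using U(2,3) by blast+
        moreover have "\<kappa> u = \<kappa> v" using \<kappa>[unfolded B] D by blast
        ultimately show "?ext \<kappa> u = ?ext \<kappa> v" by simp
      qed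
      moreover have "\<forall>v\<in>C. ?ext \<kappa> v = i" by simp
      ultimately show "?ext \<kappa> \<in> ?A" using \<kappa>[unfolded B] unfolding A image_ext by blast
    qed
  qed
qed

text \<open>Multiplying out the product chooses one variable per factor, that is, one colour per
  block. The induction sorts the block colourings by the monomial that the first block contributes,
  which matches the convolution term by term.\<close>

lemma power_sum_partition_blocks:
  assumes "distinct Cs" "pairwise disjnt (set Cs)" "\<forall>C\<in>set Cs. finite C \<and> C \<noteq> {}"
  shows "power_sum_partition (map card Cs) \<alpha> = of_nat (card (block_colorings Cs \<alpha>))"
  using assms
proof (induction Cs arbitrary: \<alpha>)
  case Nil
  have "block_colorings [] \<alpha> = (if \<alpha> = {#} then {\<lambda>_. undefined} else {})" for \<alpha>
    by (auto simp: block_colorings_def)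
  note * = this
  show ?case by (simp add: series_one_def *)
next
  case (Cons C Cs)
  let ?B = "block_colorings (C # Cs) \<alpha>" and ?M = "\<lambda>\<kappa>. image_mset \<kappa> (mset_set C)"
  let ?R = "{\<beta>. \<beta> \<subseteq># \<alpha> \<and> (\<exists>i\<ge>1. \<beta> = replicate_mset (card C) i)}"
  have C: "finite C" "C \<noteq> {}" "finite (\<Union>(set Cs))" "C \<inter> \<Union>(set Cs) = {}"
    using Cons.prems unfolding pairwise_def disjnt_def by auto
  have "finite ?B"
    by (rule finite_subset[OF _ finite_colorings[of "\<Union>(set (C # Cs))" \<alpha>]])
      (use C in \<open>auto simp: block_colorings_def\<close>)
  have finR: "finite ?R" by (rule finite_subset[OF _ finite_submultisets[of \<alpha>]]) auto
  have M: "?M ` ?B \<subseteq> ?R"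
  proof (rule image_subsetI)
    fix \<kappa> assume \<kappa>: "\<kappa> \<in> ?B"
    obtain v where v: "v \<in> C" using C by blast
    have "\<forall>u\<in>C. \<kappa> u = \<kappa> v" using \<kappa> v unfolding block_colorings_def list.set by blast
    then have "?M \<kappa> = replicate_mset (card C) (\<kappa> v)"
      by (rule iffD2[OF image_mset_replicate_iff[OF C(1)]])
    moreover have "1 \<le> \<kappa> v" using \<kappa> v unfolding block_colorings_def list.set PiE_def Pi_def by blast
    moreover have "?M \<kappa> \<subseteq># \<alpha>"
    proof -
      have "\<alpha> = image_mset \<kappa> (mset_set (C \<union> \<Union>(set Cs)))"
        using \<kappa> by (simp add: block_colorings_def)
      then show ?thesis using C by (simp add: mset_set_Union)
    qed
    ultimately show "?M \<kappa> \<in> ?R" by blast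
  qed
  have "distinct Cs" "pairwise disjnt (set Cs)" "\<forall>C\<in>set Cs. finite C \<and> C \<noteq> {}"
    using Cons.prems by (simp_all add: pairwise_insert)
  note IH = Cons.IH[OF this]
  have "power_sum_partition (map card (C # Cs)) \<alpha>
      = (\<Sum>\<beta>\<in>{\<beta>. \<beta> \<subseteq># \<alpha>}. if \<exists>i\<ge>1. \<beta> = replicate_mset (card C) i
           then of_nat (card (block_colorings Cs (\<alpha> - \<beta>))) else 0)"
  proof -
    have "(if P then 1 else 0) * x = (if P then x else 0)" for P and x :: rat by simp
    then show ?thesis
      unfolding list.map power_sum_partition_simps series_mult_def power_sum_def IH by (rule sum.cong[OF refl])
  qed
  also have "\<dots> = (\<Sum>\<beta>\<in>?R. of_nat (card (block_colorings Cs (\<alpha> - \<beta>))))"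
    by (subst sum.inter_filter[symmetric]) (simp_all add: finite_submultisets)
  also have "\<dots> = (\<Sum>\<beta>\<in>?R. of_nat (card {\<kappa> \<in> ?B. ?M \<kappa> = \<beta>}))"
  proof (rule sum.cong[OF refl])
    fix \<beta> assume "\<beta> \<in> ?R"
    then obtain i where "1 \<le> i" "\<beta> = replicate_mset (card C) i" "\<beta> \<subseteq># \<alpha>" by blast
    then show "of_nat (card (block_colorings Cs (\<alpha> - \<beta>))) = of_nat (card {\<kappa> \<in> ?B. ?M \<kappa> = \<beta>})"
      using card_block_colorings_Cons[OF C, of i \<alpha>] by simp
  qed
  also have "\<dots> = of_nat (\<Sum>\<beta>\<in>?R. card {\<kappa> \<in> ?B. ?M \<kappa> = \<beta>})" by (rule of_nat_sum[symmetric])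
  \<comment> \<open>The fibres of \<open>?M\<close> over \<open>?R\<close> partition the block
    colourings.\<close>
  also have "\<dots> = of_nat (card ?B)"
    using sum.group[OF \<open>finite ?B\<close> finR M, of "\<lambda>_. 1 :: nat"] by (simp only: card_eq_sum)
  finally show ?case .
qed

section \<open>Expansion of the chromatic symmetric function\<close>

abbreviation reach :: "'a set set \<Rightarrow> ('a \<times> 'a) set" where
  "reach S \<equiv> {(x, y). {x, y} \<in> S}\<^sup>*"

lemma reach_sym: "(x, y) \<in> reach S \<Longrightarrow> (y, x) \<in> reach S"
  by (rule symD[OF sym_rtrancl[OF symI]]) (simp_all add: insert_commute)

text \<open>Serves in two ways: with \<open>f\<close> a colouring it gives constancy on components,
  with \<open>f\<close> a truth value it shows that no walk crosses a cut.\<close>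

lemma reach_invariant:
  assumes "(x, y) \<in> reach S" "\<And>u v. {u, v} \<in> S \<Longrightarrow> f u = f v"
  shows "f x = f y"
  using assms(1) by (induction rule: rtrancl_induct) (auto dest: assms(2))

definition components :: "'a set \<Rightarrow> 'a set set \<Rightarrow> 'a set set" where
  "components V S = (\<lambda>v. {w \<in> V. (v, w) \<in> reach S}) ` V"

lemma finite_components: "finite V \<Longrightarrow> finite (components V S)"
  by (simp add: components_def)

lemma components_finite_nonempty:
  "finite V \<Longrightarrow> C \<in> components V S \<Longrightarrow> finite C \<and> C \<noteq> {}"
  by (auto simp: components_def)

lemma Union_components: "\<Union>(components V S) = V"
  by (auto simp: components_def)

lemma disjoint_components: "pairwise disjnt (components V S)"
proof (rule pairwiseI)
  fix C D assume "C \<in> components V S" "D \<in> components V S" and neq: "C \<noteq> D"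
  then obtain u v where C: "C = {w \<in> V. (u, w) \<in> reach S}" and D: "D = {w \<in> V. (v, w) \<in> reach S}"
    unfolding components_def by blast
  have "False" if "w \<in> C" "w \<in> D" for w
  proof -
    have uw: "(u, w) \<in> reach S" and vw: "(v, w) \<in> reach S" using that C D by auto
    note uv = rtrancl_trans[OF uw reach_sym[OF vw]] and vu = rtrancl_trans[OF vw reach_sym[OF uw]]
    have "(u, x) \<in> reach S \<longleftrightarrow> (v, x) \<in> reach S" for x
      using rtrancl_trans[OF uv] rtrancl_trans[OF vu] by (rule iffI[rotated])
    then show False using neq unfolding C D by simp
  qed
  then show "disjnt C D" by (auto simp: disjnt_iff)
qed

text \<open>Translates the edgewise condition that arises in inclusion-exclusion into the blockwise
  one that products of power sums count.\<close>

lemma constant_on_components_iff: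
  assumes "\<And>e. e \<in> S \<Longrightarrow> e \<subseteq> V"
  shows "(\<forall>C\<in>components V S. \<forall>u\<in>C. \<forall>v\<in>C. \<kappa> u = \<kappa> v) \<longleftrightarrow> (\<forall>u v. {u, v} \<in> S \<longrightarrow> \<kappa> u = \<kappa> v)"
    (is "?L = ?R")
proof
  assume L: ?L
  show ?R
  proof (intro allI impI)
    fix u v assume uv: "{u, v} \<in> S"
    then have "u \<in> V" "v \<in> V" using assms by auto
    let ?C = "{w \<in> V. (u, w) \<in> reach S}"
    have "?C \<in> components V S" using \<open>u \<in> V\<close> unfolding components_def by (rule imageI)
    moreover have "(u, v) \<in> reach S" using uv by (intro r_into_rtrancl) simp
    then have "u \<in> ?C" "v \<in> ?C" using \<open>u \<in> V\<close> \<open>v \<in> V\<close> by simp_all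
    ultimately show "\<kappa> u = \<kappa> v" by (rule L[rule_format])
  qed
next
  assume R: ?R
  show ?L
  proof (intro ballI)
    fix C u v assume "C \<in> components V S" "u \<in> C" "v \<in> C"
    then obtain x where "(x, u) \<in> reach S" "(x, v) \<in> reach S" by (auto simp: components_def)
    from this[THEN reach_invariant[of _ _ _ \<kappa>]] have "\<kappa> x = \<kappa> u" "\<kappa> x = \<kappa> v" using R by simp_all
    then show "\<kappa> u = \<kappa> v" by simp
  qed
qed

text \<open>Sorting by decreasing size makes \<open>component_type\<close> a partition in the list
  form of \<open>partition_of\<close>. The order among components of equal size is arbitrary and
  does not affect the type.\<close>

definition component_list :: "'a set \<Rightarrow> 'a set set \<Rightarrow> 'a set list" where
  "component_list V S =
     rev (sort_key card (SOME Cs. set Cs = components V S \<and> distinct Cs))"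

definition component_type :: "'a set \<Rightarrow> 'a set set \<Rightarrow> nat list" where
  "component_type V S = map card (component_list V S)"

lemma component_list:
  assumes "finite V"
  shows "set (component_list V S) = components V S" "distinct (component_list V S)"
proof -
  have "\<exists>Cs. set Cs = components V S \<and> distinct Cs"
    using finite_distinct_list[OF finite_components[OF assms]] .
  from someI_ex[OF this]
  show "set (component_list V S) = components V S" "distinct (component_list V S)"
    by (simp_all add: component_list_def)
qed

lemma partition_component_type:
  assumes "finite V"
  shows "partition_of (card V) (component_type V S)"
  unfolding partition_of_def
proof (intro conjI)
  show "sorted_wrt (\<ge>) (component_type V S)"
    unfolding component_type_def component_list_def rev_map[symmetric] sorted_wrt_rev
    using sorted_sort_key by simp
  show "\<forall>k\<in>set (component_type V S). 0 < k"
    using components_finite_nonempty[OF assms] component_list[OF assms]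
    by (auto simp: component_type_def card_gt_0_iff)
  have "sum_list (component_type V S) = sum card (components V S)"
    using component_list[OF assms] by (simp add: component_type_def sum_list_distinct_conv_sum_set)
  also have "\<dots> = card (\<Union>(components V S))"
    using components_finite_nonempty[OF assms]
    by (intro card_Union_disjoint[symmetric] disjoint_components) blast
  finally show "sum_list (component_type V S) = card V" by (simp add: Union_components)
qed

lemma simple_graph_finite_edges: "simple_graph V E \<Longrightarrow> finite E"
  unfolding simple_graph_def by (meson PowI finite_Pow_iff finite_subset subsetI)

text \<open>This is the expansion of the product of 1 - 1 over \<open>A\<close>.\<close>

lemma sum_Pow_minus_one: "finite A \<Longrightarrow> (\<Sum>S\<in>Pow A. (-1) ^ card S) = (if A = {} then 1 else 0 :: rat)"
  using prod_diff_conv_sum[of A "\<lambda>_. 1 :: rat" "\<lambda>_. 1"] by (simp add: power_0_left)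

text \<open>A colouring is proper iff its set \<open>mono\<close> of monochromatic edges is empty,
  and the alternating sum over subsets of \<open>mono\<close> is the indicator of that. After
  exchanging the sums, each \<open>S\<close> counts the colourings that are constant on the
  components of \<open>S\<close>.\<close>

lemma chromatic_sym_expansion:
  assumes "simple_graph V E"
  shows "chromatic_sym V E \<alpha> =
    (\<Sum>S\<in>Pow E. (-1) ^ card S * power_sum_partition (component_type V S) \<alpha>)"
proof -
  have V: "finite V" and E: "\<And>e. e \<in> E \<Longrightarrow> e \<subseteq> V"
    using assms by (auto simp: simple_graph_def)
  have fE: "finite E" using assms simple_graph_finite_edges by blast
  \<comment> \<open>All colourings with monomial \<alpha>, proper or not.\<close>
  define K where "K = {\<kappa> \<in> V \<rightarrow>\<^sub>E {1..}. image_mset \<kappa> (mset_set V) = \<alpha>}"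
  have finK: "finite K" using finite_colorings[OF V] by (simp add: K_def)
  define mono where "mono \<kappa> = {e \<in> E. \<forall>u v. e = {u, v} \<longrightarrow> \<kappa> u = \<kappa> v}" for \<kappa> :: "'a \<Rightarrow> nat"
  have mono_empty: "mono \<kappa> = {} \<longleftrightarrow> (\<forall>u v. {u, v} \<in> E \<longrightarrow> \<kappa> u \<noteq> \<kappa> v)" for \<kappa>
  proof
    assume *: "mono \<kappa> = {}"
    show "\<forall>u v. {u, v} \<in> E \<longrightarrow> \<kappa> u \<noteq> \<kappa> v"
    proof (intro allI impI notI)
      fix u v assume "{u, v} \<in> E" "\<kappa> u = \<kappa> v"
      then have "{u, v} \<in> mono \<kappa>" by (auto simp: mono_def doubleton_eq_iff)
      with * show False by simp
    qed
  next
    assume "\<forall>u v. {u, v} \<in> E \<longrightarrow> \<kappa> u \<noteq> \<kappa> v"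
    moreover have "\<exists>u v. e = {u, v}" if "e \<in> E" for e
      using assms that by (metis card_2_iff simple_graph_def)
    ultimately show "mono \<kappa> = {}" unfolding mono_def by blast
  qed
  have fin_mono: "finite (mono \<kappa>)" for \<kappa> using fE by (simp add: mono_def)
  have blocks: "{\<kappa> \<in> K. S \<subseteq> mono \<kappa>} = block_colorings (component_list V S) \<alpha>" if "S \<subseteq> E" for S
  proof -
    have "S \<subseteq> mono \<kappa> \<longleftrightarrow> (\<forall>C\<in>components V S. \<forall>u\<in>C. \<forall>v\<in>C. \<kappa> u = \<kappa> v)" for \<kappa>
      using that E by (subst constant_on_components_iff) (auto simp: mono_def)
    then show ?thesis
      unfolding block_colorings_def component_list(1)[OF V] Union_components K_def by blast
  qed
  have "chromatic_sym V E \<alpha> = of_nat (card {\<kappa> \<in> K. mono \<kappa> = {}})"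
    unfolding chromatic_sym_def proper_coloring_def mono_empty K_def
    by (rule arg_cong[where f = "\<lambda>X. of_nat (card X)"]) blast
  also have "\<dots> = (\<Sum>\<kappa>\<in>K. if mono \<kappa> = {} then 1 else 0)"
    using finK by (simp add: sum.inter_filter[symmetric])
  also have "\<dots> = (\<Sum>\<kappa>\<in>K. \<Sum>S\<in>Pow (mono \<kappa>). (-1) ^ card S)"
    by (simp add: sum_Pow_minus_one fin_mono)
  also have "\<dots> = (\<Sum>\<kappa>\<in>K. \<Sum>S | S \<in> Pow E \<and> S \<subseteq> mono \<kappa>. (-1) ^ card S)"
    by (intro sum.cong refl) (auto simp: mono_def)
  also have "\<dots> = (\<Sum>S\<in>Pow E. \<Sum>\<kappa> | \<kappa> \<in> K \<and> S \<subseteq> mono \<kappa>. (-1) ^ card S)"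
    using finK fE by (intro sum.swap_restrict) auto
  also have "\<dots> = (\<Sum>S\<in>Pow E. (-1) ^ card S * power_sum_partition (component_type V S) \<alpha>)"
  proof (rule sum.cong[OF refl])
    fix S assume "S \<in> Pow E"
    then have "power_sum_partition (component_type V S) \<alpha> = of_nat (card {\<kappa> \<in> K. S \<subseteq> mono \<kappa>})"
      using blocks[of S] component_list[OF V, of S] disjoint_components[of V S]
        components_finite_nonempty[OF V, of _ S]
      unfolding component_type_def by (subst power_sum_partition_blocks) auto
    then show "(\<Sum>\<kappa> | \<kappa> \<in> K \<and> S \<subseteq> mono \<kappa>. (-1) ^ card S)
        = (-1) ^ card S * power_sum_partition (component_type V S) \<alpha>" by simp
  qed
  finally show ?thesis .
qed

text \<open>Collecting the edge sets by their type gives an expansion of the required shape, and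
  linear independence makes it the only one.\<close>

lemma power_sum_coeff_eq:
  assumes "simple_graph V E" "partition_of (card V) \<nu>"
  shows "power_sum_coeff V E \<nu> = (\<Sum>S | S \<subseteq> E \<and> component_type V S = \<nu>. (-1) ^ card S)"
proof -
  have V: "finite V" and E: "\<And>e. e \<in> E \<Longrightarrow> e \<subseteq> V"
    using assms by (auto simp: simple_graph_def)
  have fE: "finite E" using assms simple_graph_finite_edges by blast
  let ?n = "card V"
  let ?c = "\<lambda>\<nu>. \<Sum>S | S \<in> Pow E \<and> component_type V S = \<nu>. (-1) ^ card S :: rat"
  let ?P = "\<lambda>c. (\<forall>\<nu>. \<not> partition_of ?n \<nu> \<longrightarrow> c \<nu> = 0) \<and>
    (\<forall>\<alpha>. chromatic_sym V E \<alpha> = (\<Sum>\<nu> | partition_of ?n \<nu>. c \<nu> * power_sum_partition \<nu> \<alpha>))"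
  have "chromatic_sym V E \<alpha> = (\<Sum>\<nu> | partition_of ?n \<nu>. ?c \<nu> * power_sum_partition \<nu> \<alpha>)" for \<alpha>
  proof -
    have "(\<Sum>\<nu> | partition_of ?n \<nu>. ?c \<nu> * power_sum_partition \<nu> \<alpha>)
      = (\<Sum>\<nu> | partition_of ?n \<nu>. \<Sum>S | S \<in> Pow E \<and> component_type V S = \<nu>.
          (-1) ^ card S * power_sum_partition (component_type V S) \<alpha>)"
      by (simp add: sum_distrib_right)
    also have "\<dots> = (\<Sum>S\<in>Pow E. (-1) ^ card S * power_sum_partition (component_type V S) \<alpha>)"
      using fE partition_component_type[OF V] by (intro sum.group finite_partitions) auto
    finally show ?thesis by (simp add: chromatic_sym_expansion[OF assms(1)])
  qed
  moreover have "?c \<nu> = 0" if "\<not> partition_of ?n \<nu>" for \<nu>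
  proof -
    have none: "{S. S \<in> Pow E \<and> component_type V S = \<nu>} = {}"
      using that partition_component_type[OF V] by blast
    show ?thesis unfolding none by simp
  qed
  ultimately have c: "?P ?c" by blast
  have "power_sum_coeff V E = ?c"
    unfolding power_sum_coeff_def
  proof (rule the_equality[where P = ?P, OF c])
    fix c assume c': "?P c"
    show "c = ?c"
    proof
      fix \<nu>
      show "c \<nu> = ?c \<nu>"
      proof (cases "partition_of ?n \<nu>")
        case True
        \<comment> \<open>The difference of two expansions of the same series is a vanishing
          combination of power sums.\<close>
        have "(\<Sum>\<nu> | partition_of ?n \<nu>. (c \<nu> - ?c \<nu>) * power_sum_partition \<nu> \<alpha>) = 0" for \<alpha>
          unfolding left_diff_distrib sum_subtractf using c c' by (metis (no_types, lifting) diff_self)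
        from power_sum_partition_independent[where c = "\<lambda>\<nu>. c \<nu> - ?c \<nu>", OF this True]
        show ?thesis by simp
      next
        case False
        then have "c \<nu> = 0" "?c \<nu> = 0"
          using c[THEN conjunct1] c'[THEN conjunct1] by blast+
        then show ?thesis by (simp only:)
      qed
    qed
  qed
  then show ?thesis by simp
qed

section \<open>Invariance under graph isomorphism\<close>

lemma proper_coloring_transport:
  assumes "proper_coloring A E \<kappa>" "image_mset \<kappa> (mset_set A) = \<alpha>"
    and h: "bij_betw h B A" and e: "\<And>u v. {u, v} \<in> F \<Longrightarrow> u \<in> B \<and> v \<in> B \<and> {h u, h v} \<in> E"
    and "finite B"
  shows "proper_coloring B F (restrict (\<kappa> \<circ> h) B)"
    "image_mset (restrict (\<kappa> \<circ> h) B) (mset_set B) = \<alpha>"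
proof -
  have \<kappa>: "\<kappa> \<in> A \<rightarrow>\<^sub>E {1..}" "\<And>u v. {u, v} \<in> E \<Longrightarrow> \<kappa> u \<noteq> \<kappa> v"
    using assms(1) by (auto simp: proper_coloring_def)
  have "image_mset (restrict (\<kappa> \<circ> h) B) (mset_set B) = image_mset (\<kappa> \<circ> h) (mset_set B)"
    using \<open>finite B\<close> by (intro image_mset_cong) auto
  also have "\<dots> = image_mset \<kappa> (image_mset h (mset_set B))" by (simp add: multiset.map_comp)
  also have "image_mset h (mset_set B) = mset_set A"
    using h by (metis bij_betw_def image_mset_mset_set)
  finally show "image_mset (restrict (\<kappa> \<circ> h) B) (mset_set B) = \<alpha>" using assms(2) by (simp only:)
  have "restrict (\<kappa> \<circ> h) B \<in> B \<rightarrow>\<^sub>E {1..}"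
    using \<kappa>(1) bij_betwE[OF h] by auto
  moreover have "restrict (\<kappa> \<circ> h) B u \<noteq> restrict (\<kappa> \<circ> h) B v" if "{u, v} \<in> F" for u v
    using e[OF that] \<kappa>(2)[of "h u" "h v"] by simp
  ultimately show "proper_coloring B F (restrict (\<kappa> \<circ> h) B)" by (simp add: proper_coloring_def)
qed

text \<open>Composition with an isomorphism and composition with its inverse are mutually inverse on
  proper colourings and keep the monomial. Restriction to the vertex set keeps the colourings
  extensional.\<close>

lemma chromatic_sym_iso:
  assumes "simple_graph V E" "simple_graph W F" "graph_iso V E W F"
  shows "chromatic_sym V E = chromatic_sym W F"
proof
  fix \<alpha>
  have E: "\<And>u v. {u, v} \<in> E \<Longrightarrow> u \<in> V \<and> v \<in> V" and F: "\<And>u v. {u, v} \<in> F \<Longrightarrow> u \<in> W \<and> v \<in> W"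
    using assms by (auto simp: simple_graph_def)
  have fin: "finite V" "finite W" using assms by (auto simp: simple_graph_def)
  obtain f where f: "bij_betw f V W" and ef: "\<forall>u\<in>V. \<forall>v\<in>V. {u, v} \<in> E \<longleftrightarrow> {f u, f v} \<in> F"
    using assms by (auto simp: graph_iso_def)
  define g where "g = the_inv_into V f"
  have g: "bij_betw g W V" unfolding g_def using f by (rule bij_betw_the_inv_into)
  have gf: "\<And>v. v \<in> V \<Longrightarrow> g (f v) = v" and fg: "\<And>w. w \<in> W \<Longrightarrow> f (g w) = w"
    using f by (auto simp: g_def bij_betw_def the_inv_into_f_f f_the_inv_into_f)
  have fV: "\<And>v. v \<in> V \<Longrightarrow> f v \<in> W" and gW: "\<And>w. w \<in> W \<Longrightarrow> g w \<in> V"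
    using f g by (auto simp: bij_betw_def)
  have eg: "\<forall>u\<in>W. \<forall>v\<in>W. {u, v} \<in> F \<longleftrightarrow> {g u, g v} \<in> E"
    using ef fg gW by metis
  have "card {\<kappa>. proper_coloring V E \<kappa> \<and> image_mset \<kappa> (mset_set V) = \<alpha>}
      = card {\<kappa>. proper_coloring W F \<kappa> \<and> image_mset \<kappa> (mset_set W) = \<alpha>}"
      (is "card ?A = card ?B")
  proof (rule bij_betw_same_card[OF bij_betw_byWitness[where f' = "\<lambda>\<kappa>. restrict (\<kappa> \<circ> f) V"
        and f = "\<lambda>\<kappa>. restrict (\<kappa> \<circ> g) W"]])
    show "\<forall>\<kappa>\<in>?A. restrict (restrict (\<kappa> \<circ> g) W \<circ> f) V = \<kappa>"
      using gf fV by (auto simp: proper_coloring_def PiE_def extensional_def fun_eq_iff)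
    show "\<forall>\<kappa>\<in>?B. restrict (restrict (\<kappa> \<circ> f) V \<circ> g) W = \<kappa>"
      using fg gW by (auto simp: proper_coloring_def PiE_def extensional_def fun_eq_iff)
    show "(\<lambda>\<kappa>. restrict (\<kappa> \<circ> g) W) ` ?A \<subseteq> ?B"
    proof (rule image_subsetI)
      fix \<kappa> assume "\<kappa> \<in> ?A"
      then show "restrict (\<kappa> \<circ> g) W \<in> ?B"
        using proper_coloring_transport[OF _ _ g, of E \<kappa> \<alpha> F] F eg fin by blast
    qed
    show "(\<lambda>\<kappa>. restrict (\<kappa> \<circ> f) V) ` ?B \<subseteq> ?A"
    proof (rule image_subsetI)
      fix \<kappa> assume "\<kappa> \<in> ?B"
      then show "restrict (\<kappa> \<circ> f) V \<in> ?A"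
        using proper_coloring_transport[OF _ _ f, of F \<kappa> \<alpha> E] E ef fin by blast
    qed
  qed
  then show "chromatic_sym V E \<alpha> = chromatic_sym W F \<alpha>" by (simp add: chromatic_sym_def)
qed

lemma power_sum_coeff_iso:
  assumes "simple_graph V E" "simple_graph W F" "graph_iso V E W F"
  shows "power_sum_coeff V E = power_sum_coeff W F"
proof -
  have "card V = card W" using assms(3) by (auto simp: graph_iso_def dest: bij_betw_same_card)
  then show ?thesis by (simp add: power_sum_coeff_def chromatic_sym_iso[OF assms])
qed

section \<open>Edge deletions in a spider\<close>

text \<open>For \<open>a\<close> between 1 and the largest part, this is the \<open>a\<close>-th
  part of the conjugate partition of \<open>lam\<close>.\<close>

definition leg_count :: "nat list \<Rightarrow> nat \<Rightarrow> nat" where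
  "leg_count lam a = card {i. i < length lam \<and> a \<le> lam ! i}"

abbreviation leg_edge :: "nat \<Rightarrow> nat \<Rightarrow> (nat \<times> nat) set" where
  "leg_edge i j \<equiv> {leg_vertex i j, leg_vertex i (Suc j)}"

text \<open>All positions 0 collapse into the centre; starting at position 1 makes the legs
  disjoint, so that the vertices can be counted.\<close>

lemma spider_verts_eq:
  "spider_verts lam = insert (0, 0) (SIGMA i:{..<length lam}. {1..lam ! i})"
proof
  show "spider_verts lam \<subseteq> insert (0, 0) (SIGMA i:{..<length lam}. {1..lam ! i})"
    by (auto simp: spider_verts_def leg_vertex_def)
  show "insert (0, 0) (SIGMA i:{..<length lam}. {1..lam ! i}) \<subseteq> spider_verts lam"
  proof (rule insert_subsetI)
    show "(SIGMA i:{..<length lam}. {1..lam ! i}) \<subseteq> spider_verts lam"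
    proof
      fix v assume "v \<in> (SIGMA i:{..<length lam}. {1..lam ! i})"
      then obtain i j where v: "v = (i, j)" "i < length lam" "1 \<le> j" "j \<le> lam ! i" by auto
      then have "v = leg_vertex i j" by (simp add: leg_vertex_def)
      with v show "v \<in> spider_verts lam" unfolding spider_verts_def by blast
    qed
  qed (simp add: spider_verts_def)
qed

lemma finite_spider_verts: "finite (spider_verts lam)"
  by (simp add: spider_verts_eq)

lemma card_spider_verts: "card (spider_verts lam) = Suc (sum_list lam)"
proof -
  have "card (SIGMA i:{..<length lam}. {1..lam ! i}) = sum_list lam"
    by (simp add: card_SigmaI sum_list_sum_nth atLeast0LessThan)
  then show ?thesis unfolding spider_verts_eq by (subst card_insert_disjoint) auto
qed

lemma spider_edge_iff:
  "{p, q} \<in> spider_edges lam \<longleftrightarrow> (\<exists>i j. i < length lam \<and> j < lam ! i \<and>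
     (p = leg_vertex i j \<and> q = leg_vertex i (Suc j) \<or> q = leg_vertex i j \<and> p = leg_vertex i (Suc j)))"
  by (auto simp: spider_edges_def doubleton_eq_iff)

lemma leg_vertex_in_spider_verts:
  "i < length lam \<Longrightarrow> j \<le> lam ! i \<Longrightarrow> leg_vertex i j \<in> spider_verts lam"
  by (auto simp: spider_verts_def)

lemma leg_edge_in_spider_edges:
  "i < length lam \<Longrightarrow> j < lam ! i \<Longrightarrow> leg_edge i j \<in> spider_edges lam"
  unfolding spider_edges_def by blast

lemma leg_vertex_neq_Suc: "leg_vertex i j \<noteq> leg_vertex i (Suc j)"
  by (simp add: leg_vertex_def)

text \<open>The inner endpoint may be the centre, which forgets its leg, but the outer endpoint
  always records both coordinates. Edges can therefore be counted as pairs of a leg and a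
  position.\<close>

lemma leg_edge_inject: "leg_edge i j = leg_edge i' j' \<longleftrightarrow> i = i' \<and> j = j'"
  by (auto simp: doubleton_eq_iff leg_vertex_def split: if_splits)

lemma simple_graph_spider: "simple_graph (spider_verts lam) (spider_edges lam)"
  unfolding simple_graph_def
proof (intro conjI ballI finite_spider_verts)
  fix e assume "e \<in> spider_edges lam"
  then obtain i j where "i < length lam" "j < lam ! i" "e = leg_edge i j"
    by (auto simp: spider_edges_def)
  then show "e \<subseteq> spider_verts lam" "card e = 2"
    by (auto intro: leg_vertex_in_spider_verts simp: leg_vertex_neq_Suc)
qed

lemma spider_verts_cases:
  assumes "v \<in> spider_verts lam"
  obtains "v = (0, 0)" | i j where "v = leg_vertex i j" "i < length lam" "0 < j" "j \<le> lam ! i"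
  using assms by (auto simp: spider_verts_eq leg_vertex_def)

lemma reach_along_leg:
  assumes "a \<le> b" "\<And>j. a \<le> j \<Longrightarrow> j < b \<Longrightarrow> leg_edge i j \<in> S"
  shows "(leg_vertex i a, leg_vertex i b) \<in> reach S"
  using assms
proof (induction b rule: dec_induct)
  case (step b)
  then have "(leg_vertex i b, leg_vertex i (Suc b)) \<in> {(x, y). {x, y} \<in> S}" by simp
  moreover have "(leg_vertex i a, leg_vertex i b) \<in> reach S" using step by simp
  ultimately show ?case by (rule rtrancl_into_rtrancl[rotated])
qed simp

text \<open>Lying on leg \<open>i\<close> beyond position \<open>j\<close> is a property that
  changes only across the removed edge. Since \<open>S\<close> may lack further edges, the lemma
  applies to each missing edge separately.\<close>

lemma leg_tail_separated:
  assumes "S \<subseteq> spider_edges lam - {leg_edge i j}" "(x, y) \<in> reach S"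
  shows "(fst x = i \<and> j < snd x) \<longleftrightarrow> (fst y = i \<and> j < snd y)"
  using assms(2)
proof (rule reach_invariant)
  fix u v assume "{u, v} \<in> S"
  then have "{u, v} \<in> spider_edges lam" "{u, v} \<noteq> leg_edge i j" using assms(1) by auto
  then obtain i' j' where uv:
    "u = leg_vertex i' j' \<and> v = leg_vertex i' (Suc j') \<or> v = leg_vertex i' j' \<and> u = leg_vertex i' (Suc j')"
    unfolding spider_edge_iff by blast
  with \<open>{u, v} \<noteq> leg_edge i j\<close> have "i' \<noteq> i \<or> j' \<noteq> j" by (auto simp: insert_commute)
  with uv show "(fst u = i \<and> j < snd u) = (fst v = i \<and> j < snd v)"
    by (auto simp: leg_vertex_def split: if_splits)
qed

lemma reach_spider:
  assumes "u \<in> spider_verts lam" "v \<in> spider_verts lam"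
  shows "(u, v) \<in> reach (spider_edges lam)"
proof -
  have "((0, 0), v) \<in> reach (spider_edges lam)" if "v \<in> spider_verts lam" for v
    using that
  proof (cases rule: spider_verts_cases)
    case (2 i j)
    then have "(leg_vertex i 0, leg_vertex i j) \<in> reach (spider_edges lam)"
      by (intro reach_along_leg leg_edge_in_spider_edges) auto
    with 2 show ?thesis by (simp add: leg_vertex_def)
  qed simp
  from rtrancl_trans[OF reach_sym[OF this] this] assms show ?thesis by blast
qed

lemma components_spider: "components (spider_verts lam) (spider_edges lam) = {spider_verts lam}"
proof -
  have "{w \<in> spider_verts lam. (v, w) \<in> reach (spider_edges lam)} = spider_verts lam"
    if "v \<in> spider_verts lam" for v using that reach_spider by blast
  moreover have "spider_verts lam \<noteq> {}" by (simp add: spider_verts_eq)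
  ultimately show ?thesis by (simp add: components_def image_constant_conv)
qed

text \<open>The tail beyond the cut is connected through its innermost vertex
  \<open>(i, Suc j)\<close>, everything else through the centre, and the cut separates the
  two.\<close>

lemma components_spider_delete_edge:
  assumes "i < length lam" "j < lam ! i"
  defines "A \<equiv> Pair i ` {Suc j..lam ! i}"
  shows "components (spider_verts lam) (spider_edges lam - {leg_edge i j}) = {A, spider_verts lam - A}"
proof -
  define V where "V = spider_verts lam"
  define S where "S = spider_edges lam - {leg_edge i j}"
  have A: "v \<in> A \<longleftrightarrow> fst v = i \<and> j < snd v" if "v \<in> V" for v
    using that by (auto simp: A_def V_def spider_verts_eq image_iff)
  have "A \<subseteq> V" using assms(1) by (auto simp: A_def V_def spider_verts_eq)
  have edge: "leg_edge i' j' \<in> S" if "i' < length lam" "j' < lam ! i'" "i' \<noteq> i \<or> j' \<noteq> j" for i' j'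
    using that leg_edge_in_spider_edges[of i' lam j'] by (simp add: S_def leg_edge_inject)
  have sep: "u \<in> A \<longleftrightarrow> v \<in> A" if "(u, v) \<in> reach S" "u \<in> V" "v \<in> V" for u v
    using leg_tail_separated[of S lam i j u v] that by (simp add: A S_def)
  have tail: "((i, Suc j), v) \<in> reach S" if v: "v \<in> A" for v
  proof -
    obtain b where b: "v = (i, b)" "Suc j \<le> b" "b \<le> lam ! i" using v by (auto simp: A_def)
    then have "(leg_vertex i (Suc j), leg_vertex i b) \<in> reach S"
      using assms(1) by (intro reach_along_leg edge) auto
    then show ?thesis using b by (simp add: leg_vertex_def)
  qed
  have rest: "((0, 0), v) \<in> reach S" if "v \<in> V - A" for v
  proof -
    from that have "v \<in> spider_verts lam" by (simp add: V_def)
    then show ?thesis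
    proof (cases rule: spider_verts_cases)
      case (2 i' b)
      then have "i' \<noteq> i \<or> b \<le> j" using that A[of v] by (auto simp: leg_vertex_def)
      then have "(leg_vertex i' 0, leg_vertex i' b) \<in> reach S"
        using 2 by (intro reach_along_leg edge) auto
      with 2 show ?thesis by (simp add: leg_vertex_def)
    qed simp
  qed
  have comp: "{w \<in> V. (v, w) \<in> reach S} = (if v \<in> A then A else V - A)" if v: "v \<in> V" for v
  proof (cases "v \<in> A")
    case True
    have "(v, w) \<in> reach S" if "w \<in> A" for w
      using rtrancl_trans[OF reach_sym[OF tail[OF True]] tail[OF that]] .
    then show ?thesis using True \<open>A \<subseteq> V\<close> sep[OF _ v] by auto
  next
    case False
    then have "(v, w) \<in> reach S" if "w \<in> V - A" for w
      using rtrancl_trans[OF reach_sym[OF rest] rest[OF that]] v by simp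
    then show ?thesis using False sep[OF _ v] by auto
  qed
  have "(i, Suc j) \<in> A" using assms(2) by (auto simp: A_def)
  moreover have "(0, 0) \<in> V - A" by (auto simp: V_def spider_verts_eq A_def)
  ultimately have "(\<lambda>v. if v \<in> A then A else V - A) ` V = {A, V - A}"
    using \<open>A \<subseteq> V\<close> by (auto simp: image_iff)
  moreover have "components V S = (\<lambda>v. if v \<in> A then A else V - A) ` V"
    unfolding components_def using comp by (rule image_cong[OF refl])
  ultimately have "components V S = {A, V - A}" by (simp only:)
  then show ?thesis by (simp add: V_def S_def)
qed

lemma card_components_ge_3:
  assumes "x \<in> V" "y \<in> V" "z \<in> V" "finite V"
    and "(x, y) \<notin> reach S" "(x, z) \<notin> reach S" "(y, z) \<notin> reach S"
  shows "3 \<le> card (components V S)"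
proof -
  let ?C = "\<lambda>v. {w \<in> V. (v, w) \<in> reach S}"
  have "?C x \<noteq> ?C y" "?C x \<noteq> ?C z" "?C y \<noteq> ?C z" using assms by blast+
  then have card: "card {?C x, ?C y, ?C z} = 3" by simp
  have "?C v \<in> components V S" if "v \<in> V" for v
    unfolding components_def using that by (rule imageI)
  then have "{?C x, ?C y, ?C z} \<subseteq> components V S" using assms(1-3) by simp
  from card_mono[OF finite_components[OF \<open>finite V\<close>] this] show ?thesis by (simp only: card)
qed

text \<open>With no edge missing there is one component. With two edges missing there are at least
  three, represented by the outer endpoints of those edges and by the centre.\<close>

lemma card_components_spider_eq_2:
  assumes "S \<subseteq> spider_edges lam" "card (components (spider_verts lam) S) = 2"
  obtains i j where "i < length lam" "j < lam ! i" "S = spider_edges lam - {leg_edge i j}"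
proof -
  have "S \<noteq> spider_edges lam" using assms(2) components_spider[of lam] by auto
  then obtain e where "e \<in> spider_edges lam" "e \<notin> S" using assms(1) by blast
  then obtain i j where ij: "i < length lam" "j < lam ! i" "leg_edge i j \<notin> S"
    by (auto simp: spider_edges_def)
  have "S = spider_edges lam - {leg_edge i j}"
  proof (rule ccontr)
    assume "S \<noteq> spider_edges lam - {leg_edge i j}"
    then obtain e where e: "e \<in> spider_edges lam" "e \<notin> S" "e \<noteq> leg_edge i j"
      using assms(1) ij(3) by blast
    then obtain i' j' where ij': "i' < length lam" "j' < lam ! i'" "e = leg_edge i' j'"
      by (auto simp: spider_edges_def)
    have neq: "i' \<noteq> i \<or> j' \<noteq> j" using e ij' by auto
    have "S \<subseteq> spider_edges lam - {leg_edge i j}" "S \<subseteq> spider_edges lam - {leg_edge i' j'}"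
      using assms(1) e ij ij' by auto
    note sep = this[THEN leg_tail_separated]
    have "3 \<le> card (components (spider_verts lam) S)"
    proof (rule card_components_ge_3)
      show "(i, Suc j) \<in> spider_verts lam" "(i', Suc j') \<in> spider_verts lam" "(0, 0) \<in> spider_verts lam"
        using ij ij' by (auto simp: spider_verts_eq)
      show "finite (spider_verts lam)" by (rule finite_spider_verts)
      show "((i, Suc j), (0, 0)) \<notin> reach S" "((i', Suc j'), (0, 0)) \<notin> reach S"
        using sep(1)[of "(i, Suc j)" "(0, 0)"] sep(2)[of "(i', Suc j')" "(0, 0)"] by auto
      \<comment> \<open>On a common leg, the cut farther from the centre separates the two outer
        endpoints; on different legs either cut does.\<close>
      show "((i, Suc j), (i', Suc j')) \<notin> reach S"
        using sep[of "(i, Suc j)" "(i', Suc j')"] neq by auto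
    qed
    then show False using assms(2) by simp
  qed
  with ij that show ?thesis by blast
qed

text \<open>The type is weakly decreasing and \<open>2 * a\<close> is at most \<open>card V\<close>,
  so \<open>[card V - a, a]\<close> is the right order of the two sizes, whichever side has
  \<open>a\<close> vertices.\<close>

lemma component_type_eq_pair:
  assumes "finite V" "components V S = {A, V - A}" "A \<noteq> V - A" "A \<subseteq> V" "1 \<le> a" "2 * a \<le> card V"
  shows "component_type V S = [card V - a, a] \<longleftrightarrow> card A = a \<or> card A = card V - a"
proof -
  let ?n = "card V"
  have fA: "finite A" using assms finite_subset by blast
  have card: "card (V - A) = ?n - card A" "card A \<le> ?n"
    using assms fA by (auto simp: card_Diff_subset card_mono)
  have "length (component_list V S) = 2"
    using component_list[OF assms(1), of S] assms(2,3) distinct_card[of "component_list V S"] by simp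
  then obtain X Y where XY: "component_list V S = [X, Y]"
    by (auto simp: numeral_2_eq_2 length_Suc_conv)
  have "{X, Y} = {A, V - A}" "X \<noteq> Y"
    using component_list[OF assms(1), of S] assms(2) XY by auto
  then have "X = A \<and> Y = V - A \<or> X = V - A \<and> Y = A" by (auto simp: doubleton_eq_iff)
  then have "component_type V S = [card A, ?n - card A] \<or> component_type V S = [?n - card A, card A]"
    using XY card by (auto simp: component_type_def)
  moreover have "sorted_wrt (\<ge>) (component_type V S)"
    using partition_component_type[OF assms(1)] by (simp add: partition_of_def)
  ultimately show ?thesis using assms(5,6) card(2) by auto
qed

lemma component_type_spider_delete_edge:
  assumes "i < length lam" "j < lam ! i" "n = Suc (sum_list lam)" "1 \<le> a" "2 * a \<le> n"
  shows "component_type (spider_verts lam) (spider_edges lam - {leg_edge i j}) = [n - a, a]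
    \<longleftrightarrow> lam ! i - j = a \<or> lam ! i - j = n - a"
proof -
  let ?A = "Pair i ` {Suc j..lam ! i}"
  have "card ?A = lam ! i - j" by (simp add: card_image inj_on_def)
  moreover have "(i, Suc j) \<in> ?A" "(0, 0) \<in> spider_verts lam - ?A"
    using assms by (auto simp: spider_verts_eq)
  then have "?A \<noteq> spider_verts lam - ?A" by blast
  moreover have "?A \<subseteq> spider_verts lam" using assms by (auto simp: spider_verts_eq)
  ultimately show ?thesis
    using component_type_eq_pair[OF finite_spider_verts components_spider_delete_edge[OF assms(1,2)]] assms
    by (simp add: card_spider_verts)
qed

text \<open>A leg of length at least \<open>b\<close>, with \<open>b\<close> positive, has exactly
  one cut that leaves a tail of \<open>b\<close> vertices, at position \<open>lam ! i - b\<close>.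
  If \<open>2 * a = n\<close>, the two conditions on the tail coincide and must be counted
  once.\<close>

lemma card_leg_positions:
  assumes "1 \<le> a" "a < n"
  shows "card {(i, j). i < length lam \<and> j < lam ! i \<and> (lam ! i - j = a \<or> lam ! i - j = n - a)}
    = leg_count lam a + (if 2 * a = n then 0 else leg_count lam (n - a))"
proof -
  define P where "P b = (\<lambda>i. (i, lam ! i - b)) ` {i. i < length lam \<and> b \<le> lam ! i}" for b
  have card: "card (P b) = leg_count lam b" for b
    unfolding P_def leg_count_def by (rule card_image) (auto simp: inj_on_def)
  have fin: "finite (P b)" for b by (simp add: P_def)
  have P: "(i, j) \<in> P b \<longleftrightarrow> i < length lam \<and> j < lam ! i \<and> lam ! i - j = b" if "1 \<le> b" for i j b
    using that by (auto simp: P_def)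
  have U: "{(i, j). i < length lam \<and> j < lam ! i \<and> (lam ! i - j = a \<or> lam ! i - j = n - a)}
      = P a \<union> P (n - a)"
    using assms P[of a] P[of "n - a"] by auto
  show ?thesis
  proof (cases "2 * a = n")
    case True
    then have "n - a = a" by simp
    then show ?thesis unfolding U using True by (simp add: card)
  next
    case False
    have "P a \<inter> P (n - a) = {}"
      using assms False P[of a] P[of "n - a"] by auto
    then show ?thesis unfolding U using False by (simp add: card_Un_disjoint fin card)
  qed
qed

text \<open>The contributing edge sets correspond to cut positions. Each has one edge less than the
  spider, so all signs agree and the absolute value is a plain count.\<close>

lemma abs_power_sum_coeff_spider:
  assumes "n = Suc (sum_list lam)" "1 \<le> a" "2 * a \<le> n"
  shows "\<bar>power_sum_coeff (spider_verts lam) (spider_edges lam) [n - a, a]\<bar>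
    = of_nat (leg_count lam a + (if 2 * a = n then 0 else leg_count lam (n - a)))"
proof -
  define V where "V = spider_verts lam"
  define F where "F = spider_edges lam"
  define J where "J = {(i, j). i < length lam \<and> j < lam ! i \<and> (lam ! i - j = a \<or> lam ! i - j = n - a)}"
  let ?X = "{S. S \<subseteq> F \<and> component_type V S = [n - a, a]}"
  let ?del = "\<lambda>(i, j). F - {leg_edge i j}"
  have edge: "leg_edge i j \<in> F" if "(i, j) \<in> J" for i j
    using that leg_edge_in_spider_edges by (simp add: J_def F_def)
  have X: "?X = ?del ` J"
  proof
    show "?X \<subseteq> ?del ` J"
    proof
      fix S assume S: "S \<in> ?X"
      have "length (component_type V S) = 2" using S by simp
      then have "length (component_list V S) = 2" by (simp add: component_type_def)
      then have "card (components V S) = 2"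
        using component_list[OF finite_spider_verts] distinct_card V_def by metis
      then obtain i j where ij: "i < length lam" "j < lam ! i" "S = F - {leg_edge i j}"
        using S card_components_spider_eq_2[of S lam] by (auto simp: V_def F_def)
      then have "(i, j) \<in> J"
        using S component_type_spider_delete_edge[OF ij(1,2) assms] by (simp add: J_def V_def F_def)
      then show "S \<in> ?del ` J" using ij by force
    qed
    show "?del ` J \<subseteq> ?X"
      using component_type_spider_delete_edge[OF _ _ assms] by (auto simp: J_def V_def F_def)
  qed
  have inj: "inj_on ?del J"
  proof (rule inj_onI, clarify)
    fix i j i' j' assume "(i, j) \<in> J" "(i', j') \<in> J" "F - {leg_edge i j} = F - {leg_edge i' j'}"
    then have "leg_edge i j = leg_edge i' j'" using edge by blast
    then show "i = i' \<and> j = j'" by (simp add: leg_edge_inject)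
  qed
  have "card S = card F - 1" if S: "S \<in> ?X" for S
  proof -
    from S[unfolded X] obtain i j where "(i, j) \<in> J" "S = F - {leg_edge i j}" by auto
    then show ?thesis using edge[of i j] by (simp add: card_Diff_singleton)
  qed
  then have "(\<Sum>S\<in>?X. (-1) ^ card S) = (\<Sum>S\<in>?X. (-1 :: rat) ^ (card F - 1))"
    by (intro sum.cong) auto
  also have "\<dots> = of_nat (card J) * (-1) ^ (card F - 1)"
    unfolding X sum_constant card_image[OF inj] ..
  finally have "\<bar>\<Sum>S\<in>?X. (-1 :: rat) ^ card S\<bar> = of_nat (card J)"
    by (simp add: abs_mult power_abs)
  moreover have "partition_of (card V) [n - a, a]"
    using assms by (simp add: V_def card_spider_verts partition_of_def)
  ultimately show ?thesis
    using power_sum_coeff_eq[OF simple_graph_spider, of lam "[n - a, a]"] card_leg_positions[of a n lam] assms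
    by (simp add: V_def F_def J_def)
qed

section \<open>Leg decomposition of spiders\<close>

lemma reach_distinct_path:
  assumes "(u, v) \<in> reach S"
  obtains p where "p \<noteq> []" "hd p = u" "last p = v" "distinct p" "successively (\<lambda>x y. {x, y} \<in> S) p"
proof -
  let ?P = "\<lambda>v p. p \<noteq> [] \<and> hd p = u \<and> last p = v \<and> distinct p \<and> successively (\<lambda>x y. {x, y} \<in> S) p"
  have "\<exists>p. ?P v p" using assms
  proof (induction rule: rtrancl_induct)
    case base
    have "?P u [u]" by simp
    then show ?case ..
  next
    case (step y z)
    then obtain p where p: "?P y p" by blast
    have edge: "{y, z} \<in> S" using step by simp
    show ?case
    proof (cases "z \<in> set p")
      case True
      \<comment> \<open>When the walk returns to \<open>z\<close>, the path is cut off at the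
        earlier visit.\<close>
      then obtain xs ys where split: "p = (xs @ [z]) @ ys" by (auto dest: split_list)
      have "?P z (xs @ [z])"
        using p unfolding split successively_append_iff[of _ "xs @ [z]"]
        by (auto simp: hd_append split: if_splits)
      then show ?thesis ..
    next
      case False
      then have "?P z (p @ [z])" using p edge by (auto simp: successively_append_iff)
      then show ?thesis ..
    qed
  qed
  then show ?thesis using that by blast
qed

text \<open>A simple path from \<open>u\<close> to \<open>v\<close> that avoids the edge between
  them would close up with that edge to a cycle.\<close>

lemma acyclic_no_detour:
  assumes "\<nexists>vs. graph_cycle E vs" "{u, v} \<in> E" "u \<noteq> v" "S \<subseteq> E" "{u, v} \<notin> S"
  shows "(u, v) \<notin> reach S"
proof
  assume "(u, v) \<in> reach S"
  then obtain p where p: "p \<noteq> []" "hd p = u" "last p = v" "distinct p"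
    "successively (\<lambda>x y. {x, y} \<in> S) p" by (rule reach_distinct_path)
  have edges: "{p ! i, p ! Suc i} \<in> S" if "Suc i < length p" for i
    using p(5) that by (auto simp: successively_conv_nth)
  have ends: "p ! 0 = u" "p ! (length p - 1) = v" using p by (auto simp: hd_conv_nth last_conv_nth)
  \<comment> \<open>Length 1 would give \<open>u = v\<close>, and length 2 would put the edge itself
    into \<open>S\<close>.\<close>
  have "length p \<noteq> 0" "length p \<noteq> 1" "length p \<noteq> 2"
    using p(1) ends assms(3,5) edges[of 0] by (auto simp: numeral_2_eq_2)
  then have len: "3 \<le> length p" by linarith
  have "{p ! i, p ! (Suc i mod length p)} \<in> E" if "i < length p" for i
  proof (cases "Suc i < length p")
    case True
    then show ?thesis using edges assms(4) by auto
  next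
    case False
    then have "Suc i = length p" using that by simp
    then have i: "i = length p - 1" "Suc i mod length p = 0" by simp_all
    show ?thesis unfolding i(2) unfolding i(1) ends using assms(2) by (simp add: insert_commute)
  qed
  then have "graph_cycle E p" using len p(4) by (simp add: graph_cycle_def)
  then show False using assms(1) by blast
qed

lemma reach_map:
  assumes "(x, y) \<in> reach F" "\<And>a b. {a, b} \<in> F \<Longrightarrow> {f a, f b} \<in> S"
  shows "(f x, f y) \<in> reach S"
  using assms(1)
proof (induction rule: rtrancl_induct)
  case (step y z)
  then have "(f y, f z) \<in> {(x, y). {x, y} \<in> S}" using assms(2) by simp
  with step(3) show ?case by (rule rtrancl_into_rtrancl)
qed simp

lemma graph_iso_sym:
  assumes "graph_iso V E W F"
  shows "graph_iso W F V E"
proof -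
  obtain f where f: "bij_betw f V W" and ef: "\<forall>u\<in>V. \<forall>v\<in>V. {u, v} \<in> E \<longleftrightarrow> {f u, f v} \<in> F"
    using assms by (auto simp: graph_iso_def)
  let ?g = "the_inv_into V f"
  have g: "bij_betw ?g W V" using f by (rule bij_betw_the_inv_into)
  have "{u, v} \<in> F \<longleftrightarrow> {?g u, ?g v} \<in> E" if "u \<in> W" "v \<in> W" for u v
  proof -
    have "f (?g u) = u" "f (?g v) = v"
      using f that by (auto simp: bij_betw_def f_the_inv_into_f)
    moreover have "?g u \<in> V" "?g v \<in> V" using g that by (auto simp: bij_betw_def)
    ultimately show ?thesis using ef by metis
  qed
  then show ?thesis unfolding graph_iso_def using g by blast
qed

lemma graph_iso_trans:
  assumes "graph_iso V E W F" "graph_iso W F X G"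
  shows "graph_iso V E X G"
proof -
  obtain f where f: "bij_betw f V W" "\<forall>u\<in>V. \<forall>v\<in>V. {u, v} \<in> E \<longleftrightarrow> {f u, f v} \<in> F"
    using assms(1) by (auto simp: graph_iso_def)
  obtain g where g: "bij_betw g W X" "\<forall>u\<in>W. \<forall>v\<in>W. {u, v} \<in> F \<longleftrightarrow> {g u, g v} \<in> G"
    using assms(2) by (auto simp: graph_iso_def)
  have "bij_betw (g \<circ> f) V X" using f g by (blast intro: bij_betw_trans)
  moreover have "{u, v} \<in> E \<longleftrightarrow> {(g \<circ> f) u, (g \<circ> f) v} \<in> G" if "u \<in> V" "v \<in> V" for u v
    using f(2) g(2) that bij_betwE[OF f(1)] by simp
  ultimately show ?thesis unfolding graph_iso_def by blast
qed

text \<open>Legs are found in the tree in no particular order, while \<open>is_spider_T\<close> asks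
  for a weakly decreasing list; this lemma permits sorting.\<close>

lemma graph_iso_spider_permute:
  assumes "mset lam = mset lam'"
  shows "graph_iso (spider_verts lam) (spider_edges lam) (spider_verts lam') (spider_edges lam')"
proof -
  obtain \<pi> where \<pi>: "bij_betw \<pi> {..<length lam} {..<length lam'}"
    and nth: "\<forall>i<length lam. lam ! i = lam' ! \<pi> i"
    using permutation_Ex_bij[OF assms] by blast
  \<comment> \<open>\<open>leg_vertex\<close> in place of a plain pair keeps the centre at
    \<open>(0, 0)\<close> even when \<pi> moves 0.\<close>
  define g where "g = (\<lambda>(i, j). leg_vertex (\<pi> i) j)"
  have g: "g (leg_vertex i j) = leg_vertex (\<pi> i) j" for i j by (simp add: g_def leg_vertex_def)
  have lt: "\<pi> i < length lam'" if "i < length lam" for i using \<pi> that by (auto simp: bij_betw_def)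
  have inj: "\<pi> i = \<pi> i' \<longleftrightarrow> i = i'" if "i < length lam" "i' < length lam" for i i'
    using \<pi> that by (auto simp: bij_betw_def inj_on_def)
  have "inj_on g (spider_verts lam)"
    by (rule inj_onI) (auto simp: g_def leg_vertex_def spider_verts_eq inj split: if_splits)
  moreover have "g ` spider_verts lam \<subseteq> spider_verts lam'"
    using lt nth by (auto simp: g_def leg_vertex_def spider_verts_eq)
  moreover have "card (spider_verts lam) = card (spider_verts lam')"
    using assms by (metis card_spider_verts sum_mset_sum_list)
  ultimately have bij: "bij_betw g (spider_verts lam) (spider_verts lam')"
    unfolding bij_betw_def by (metis card_image card_subset_eq finite_spider_verts)
  have "{u, v} \<in> spider_edges lam \<longleftrightarrow> {g u, g v} \<in> spider_edges lam'"
    if uv: "u \<in> spider_verts lam" "v \<in> spider_verts lam" for u v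
  proof
    assume "{u, v} \<in> spider_edges lam"
    then show "{g u, g v} \<in> spider_edges lam'"
      unfolding spider_edge_iff using lt nth g by metis
  next
    assume "{g u, g v} \<in> spider_edges lam'"
    then obtain i j where ij: "i < length lam'" "j < lam' ! i" "{g u, g v} = leg_edge i j"
      unfolding spider_edges_def by blast
    obtain i' where i': "i' < length lam" "i = \<pi> i'" using \<pi> ij(1) unfolding bij_betw_def by auto
    have mem: "leg_vertex i' j \<in> spider_verts lam" "leg_vertex i' (Suc j) \<in> spider_verts lam"
      using i' ij nth by (auto intro!: leg_vertex_in_spider_verts)
    have "g ` {u, v} = g ` leg_edge i' j" using ij(3) by (simp add: g i'(2))
    then have "{u, v} = leg_edge i' j"
      by (rule inj_on_image_eq_iff[OF \<open>inj_on g (spider_verts lam)\<close>, THEN iffD1, rotated -1])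
        (use uv mem in simp_all)
    moreover have "leg_edge i' j \<in> spider_edges lam"
      using i' ij nth by (intro leg_edge_in_spider_edges) auto
    ultimately show "{u, v} \<in> spider_edges lam" by simp
  qed
  with bij show ?thesis unfolding graph_iso_def by blast
qed

section \<open>The two ways of growing a spider: a new leg of length 1, or one more vertex on a
  leg\<close>

lemma spider_verts_append: "spider_verts (lam @ [1]) = insert (length lam, 1) (spider_verts lam)"
  by (auto simp: spider_verts_eq nth_append less_Suc_eq split: if_splits)

lemma spider_edges_append:
  "spider_edges (lam @ [1]) = insert {(0, 0), (length lam, 1)} (spider_edges lam)"
proof
  show "spider_edges (lam @ [1]) \<subseteq> insert {(0, 0), (length lam, 1)} (spider_edges lam)"
  proof
    fix e assume "e \<in> spider_edges (lam @ [1])"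
    then obtain i j where "i < length (lam @ [1])" "j < (lam @ [1]) ! i" "e = leg_edge i j"
      unfolding spider_edges_def by blast
    then consider "i < length lam" "j < lam ! i" "e = leg_edge i j" | "e = leg_edge (length lam) 0"
      by (cases "i < length lam") (auto simp: nth_append less_Suc_eq)
    then show "e \<in> insert {(0, 0), (length lam, 1)} (spider_edges lam)"
      by cases (simp add: leg_edge_in_spider_edges, simp add: leg_vertex_def)
  qed
  have "leg_edge (length lam) 0 \<in> spider_edges (lam @ [1])"
    by (rule leg_edge_in_spider_edges) auto
  moreover have "leg_edge i j \<in> spider_edges (lam @ [1])" if "i < length lam" "j < lam ! i" for i j
    using that by (intro leg_edge_in_spider_edges) (auto simp: nth_append)
  then have "spider_edges lam \<subseteq> spider_edges (lam @ [1])"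
    unfolding spider_edges_def[of lam] by blast
  ultimately show "insert {(0, 0), (length lam, 1)} (spider_edges lam) \<subseteq> spider_edges (lam @ [1])"
    by (simp add: leg_vertex_def)
qed

lemma spider_verts_extend:
  assumes "i < length lam"
  shows "spider_verts (lam[i := Suc (lam ! i)]) = insert (i, Suc (lam ! i)) (spider_verts lam)"
  using assms by (auto simp: spider_verts_eq nth_list_update le_Suc_eq split: if_splits)

lemma spider_edges_extend:
  assumes "i < length lam"
  shows "spider_edges (lam[i := Suc (lam ! i)]) = insert (leg_edge i (lam ! i)) (spider_edges lam)"
    (is "spider_edges ?lam = _")
proof
  show "spider_edges ?lam \<subseteq> insert (leg_edge i (lam ! i)) (spider_edges lam)"
  proof
    fix e assume "e \<in> spider_edges ?lam"
    then obtain i' j where ij: "i' < length lam" "j < ?lam ! i'" "e = leg_edge i' j"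
      unfolding spider_edges_def by auto
    show "e \<in> insert (leg_edge i (lam ! i)) (spider_edges lam)"
    proof (cases "j < lam ! i'")
      case True
      then show ?thesis using ij leg_edge_in_spider_edges by blast
    next
      case False
      then have "i' = i \<and> j = lam ! i" using ij assms by (auto simp: nth_list_update split: if_splits)
      then show ?thesis using ij by simp
    qed
  qed
  have "leg_edge i (lam ! i) \<in> spider_edges ?lam"
    using assms by (intro leg_edge_in_spider_edges) auto
  moreover have "leg_edge i' j \<in> spider_edges ?lam" if "i' < length lam" "j < lam ! i'" for i' j
    using that assms by (intro leg_edge_in_spider_edges) (auto simp: nth_list_update)
  then have "spider_edges lam \<subseteq> spider_edges ?lam"
    unfolding spider_edges_def[of lam] by blast
  ultimately show "insert (leg_edge i (lam ! i)) (spider_edges lam) \<subseteq> spider_edges ?lam" by simp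
qed

text \<open>The equivalence on edges makes the image an induced subgraph, so an embedding onto all
  of \<open>V\<close> is an isomorphism. Legs of length 0 are excluded because the list is to become
  a partition.\<close>

definition spider_embedding ::
  "'a set \<Rightarrow> 'a set set \<Rightarrow> 'a \<Rightarrow> nat list \<Rightarrow> (nat \<times> nat \<Rightarrow> 'a) \<Rightarrow> bool" where
  "spider_embedding V E c lam f \<longleftrightarrow> (\<forall>k\<in>set lam. 0 < k) \<and>
     inj_on f (spider_verts lam) \<and> f ` spider_verts lam \<subseteq> V \<and> f (0, 0) = c \<and>
     (\<forall>p\<in>spider_verts lam. \<forall>q\<in>spider_verts lam. {f p, f q} \<in> E \<longleftrightarrow> {p, q} \<in> spider_edges lam)"

text \<open>Common form of both growth moves: a leaf \<open>p\<close> is attached at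
  \<open>q\<close> in the model, and its image \<open>v\<close> has \<open>f q\<close> as its only
  neighbour in the copy built so far.\<close>

lemma spider_embedding_insert:
  assumes f: "spider_embedding V E c lam f" and "simple_graph V E"
    and lam': "\<forall>k\<in>set lam'. 0 < k" "spider_verts lam' = insert p (spider_verts lam)"
      "spider_edges lam' = insert {q, p} (spider_edges lam)"
    and p: "p \<notin> spider_verts lam" and q: "q \<in> spider_verts lam"
    and v: "v \<in> V" "v \<notin> f ` spider_verts lam"
      "\<And>r. r \<in> spider_verts lam \<Longrightarrow> {f r, v} \<in> E \<longleftrightarrow> r = q"
  shows "spider_embedding V E c lam' (f(p := v))"
  unfolding spider_embedding_def
proof (intro conjI ballI)
  let ?f = "f(p := v)" and ?V = "spider_verts lam" and ?E = "spider_edges lam"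
  have f: "inj_on f ?V" "f ` ?V \<subseteq> V" "f (0, 0) = c"
    "\<And>p q. p \<in> ?V \<Longrightarrow> q \<in> ?V \<Longrightarrow> {f p, f q} \<in> E \<longleftrightarrow> {p, q} \<in> ?E"
    using f by (auto simp: spider_embedding_def)
  have "(0, 0) \<noteq> p" using p by (auto simp: spider_verts_eq)
  then show "?f (0, 0) = c" using f(3) by simp
  have im: "?f ` ?V = f ` ?V" using p by (intro image_cong) auto
  show "inj_on ?f (spider_verts lam')"
    unfolding lam'(2) using p v(2) f(1) by (auto simp: inj_on_def im)
  show "?f ` spider_verts lam' \<subseteq> V"
    unfolding lam'(2) image_insert im using f(2) v(1) by simp
  show "0 < k" if "k \<in> set lam'" for k using lam'(1) that by blast
  have E: "\<And>x y. {x, y} \<in> ?E \<Longrightarrow> x \<in> ?V \<and> y \<in> ?V \<and> x \<noteq> y"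
    using simple_graph_spider[of lam] by (fastforce simp: simple_graph_def)
  have "{v} \<notin> E" using assms(2) by (auto simp: simple_graph_def)
  fix x y assume "x \<in> spider_verts lam'" "y \<in> spider_verts lam'"
  then consider "x = p" "y = p" | "x = p" "y \<in> ?V" | "x \<in> ?V" "y = p" | "x \<in> ?V" "y \<in> ?V"
    using lam'(2) by blast
  then show "{?f x, ?f y} \<in> E \<longleftrightarrow> {x, y} \<in> spider_edges lam'"
  proof cases
    case 1
    have "p \<noteq> q" using p q by blast
    then show ?thesis using 1 \<open>{v} \<notin> E\<close> E[of p p] lam'(3) by auto
  next
    case 2
    then have "y \<noteq> p" using p by blast
    then show ?thesis using 2 v(3)[of y] E[of p y] p lam'(3)
      by (auto simp: doubleton_eq_iff insert_commute)
  next
    case 3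
    then have "x \<noteq> p" using p by blast
    then show ?thesis using 3 v(3)[of x] E[of x p] p lam'(3) by (auto simp: doubleton_eq_iff)
  next
    case 4
    then have "x \<noteq> p" "y \<noteq> p" using p by blast+
    then show ?thesis using 4 f(4)[of x y] lam'(3) by (auto simp: doubleton_eq_iff)
  qed
qed

text \<open>The copy is connected, so a vertex outside it with two neighbours inside would lie on a
  cycle.\<close>

lemma spider_embedding_unique_neighbour:
  assumes f: "spider_embedding V E c lam f" and E: "simple_graph V E" "\<nexists>vs. graph_cycle E vs"
    and q: "q \<in> spider_verts lam" "r \<in> spider_verts lam" "{f q, v} \<in> E" "{f r, v} \<in> E"
    and v: "v \<notin> f ` spider_verts lam"
  shows "r = q"
proof (rule ccontr)
  assume "r \<noteq> q"
  let ?W = "f ` spider_verts lam"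
  \<comment> \<open>The edges inside the copy together with the edge from \<open>f r\<close> to
    \<open>v\<close>: they lead from \<open>f q\<close> to \<open>v\<close> without using the edge
    between these two.\<close>
  let ?S = "insert {f r, v} {e \<in> E. e \<subseteq> ?W}"
  have neq: "f q \<noteq> f r" using f q \<open>r \<noteq> q\<close> by (auto simp: spider_embedding_def inj_on_def)
  have "f q \<noteq> v" "f r \<noteq> v" using q v by blast+
  have "{f a, f b} \<in> ?S" if ab: "{a, b} \<in> spider_edges lam" for a b
  proof -
    have "a \<in> spider_verts lam" "b \<in> spider_verts lam"
      using simple_graph_spider[of lam] ab by (auto simp: simple_graph_def)
    then show ?thesis using f ab by (simp add: spider_embedding_def)
  qed
  from reach_map[of _ _ _ f, OF reach_spider[OF q(1,2)] this] have "(f q, f r) \<in> reach ?S" .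
  moreover have "(f r, v) \<in> {(x, y). {x, y} \<in> ?S}" by simp
  ultimately have "(f q, v) \<in> reach ?S" by (rule rtrancl_into_rtrancl)
  moreover have "{f q, v} \<notin> ?S" using neq \<open>f r \<noteq> v\<close> v by (auto simp: doubleton_eq_iff)
  moreover have "?S \<subseteq> E" using q by auto
  ultimately show False using acyclic_no_detour[OF E(2) q(3) \<open>f q \<noteq> v\<close>] by blast
qed

lemma degree_ge_3:
  assumes "finite E" "{u, x} \<in> E" "{u, y} \<in> E" "{u, z} \<in> E" "x \<noteq> y" "x \<noteq> z" "y \<noteq> z"
  shows "3 \<le> degree E u"
proof -
  have "card {{u, x}, {u, y}, {u, z}} = 3" using assms(5-7) by (auto simp: doubleton_eq_iff)
  moreover have "card {{u, x}, {u, y}, {u, z}} \<le> card {e \<in> E. u \<in> e}"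
    using assms(1-4) by (intro card_mono) auto
  ultimately show ?thesis unfolding degree_def by (simp only:)
qed

text \<open>Connectedness supplies an edge leaving the copy. If it starts at the centre, a new leg
  begins; if at the end of a leg, that leg grows; the degree condition rules out any other
  start.\<close>

lemma spider_embedding_exists:
  assumes "tree_graph V E" "c \<in> V" "\<And>v. v \<in> V \<Longrightarrow> v \<noteq> c \<Longrightarrow> \<not> 3 \<le> degree E v"
    and "1 \<le> k" "k \<le> card V"
  shows "\<exists>lam f. spider_embedding V E c lam f \<and> card (spider_verts lam) = k"
  using assms(4,5)
proof (induction k rule: dec_induct)
  case base
  have E: "simple_graph V E" using assms(1) by (simp add: tree_graph_def)
  have "spider_verts [] = {(0, 0)}" "spider_edges [] = {}"
    by (auto simp: spider_verts_eq spider_edges_def)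
  moreover have "{c} \<notin> E" using E by (auto simp: simple_graph_def)
  ultimately have "spider_embedding V E c [] (\<lambda>_. c) \<and> card (spider_verts []) = 1"
    using assms(2) by (simp add: spider_embedding_def)
  then show ?case by blast
next
  case (step k)
  have E: "simple_graph V E" "\<nexists>vs. graph_cycle E vs" and conn: "connected_graph V E"
    using assms(1) by (auto simp: tree_graph_def)
  from step obtain lam f where f: "spider_embedding V E c lam f" and k: "card (spider_verts lam) = k"
    by auto
  let ?V = "spider_verts lam"
  let ?W = "f ` ?V"
  have inj: "inj_on f ?V" and W: "?W \<subseteq> V" and f0: "f (0, 0) = c" and pos: "\<forall>k\<in>set lam. 0 < k"
    and adj: "\<And>p q. p \<in> ?V \<Longrightarrow> q \<in> ?V \<Longrightarrow> {p, q} \<in> spider_edges lam \<Longrightarrow> {f p, f q} \<in> E"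
    using f by (auto simp: spider_embedding_def)
  have "card ?W = k" using card_image[OF inj] k by simp
  then obtain z where z: "z \<in> V" "z \<notin> ?W" using W step.prems by (metis Suc_n_not_le_n subsetI subset_antisym)
  have "c \<in> ?W" using f0 by (force simp: spider_verts_eq)
  have "\<exists>u v. {u, v} \<in> E \<and> u \<in> ?W \<and> v \<notin> ?W"
  proof (rule ccontr)
    assume *: "\<nexists>u v. {u, v} \<in> E \<and> u \<in> ?W \<and> v \<notin> ?W"
    have "(c, z) \<in> reach E" using conn assms(2) z by (simp add: connected_graph_def)
    then have "c \<in> ?W \<longleftrightarrow> z \<in> ?W"
    proof (rule reach_invariant)
      fix u v assume "{u, v} \<in> E"
      moreover from this have "{v, u} \<in> E" by (simp add: insert_commute)
      ultimately show "(u \<in> ?W) = (v \<in> ?W)" using * by blast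
    qed
    then show False using \<open>c \<in> ?W\<close> z by blast
  qed
  then obtain q v where q: "q \<in> ?V" "{f q, v} \<in> E" and v: "v \<notin> ?W" by blast
  have "v \<in> V" using E(1) q(2) by (auto simp: simple_graph_def)
  have uniq: "{f r, v} \<in> E \<longleftrightarrow> r = q" if "r \<in> ?V" for r
    using spider_embedding_unique_neighbour[OF f E q(1) that q(2) _ v] q(2) by blast
  note extend = spider_embedding_insert[OF f E(1) _ _ _ _ q(1) \<open>v \<in> V\<close> v uniq]
  have fin: "finite ?V" by (rule finite_spider_verts)
  from q(1) show ?case
  proof (cases rule: spider_verts_cases)
    case 1
    let ?p = "(length lam, 1)"
    have "?p \<notin> ?V" by (auto simp: spider_verts_eq)
    moreover have "\<forall>k\<in>set (lam @ [1]). 0 < k" using pos by auto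
    ultimately have "spider_embedding V E c (lam @ [1]) (f(?p := v))"
      using 1 by (intro extend) (simp_all only: spider_verts_append spider_edges_append not_False_eq_True)
    moreover have "card (spider_verts (lam @ [1])) = Suc k"
      unfolding spider_verts_append using \<open>?p \<notin> ?V\<close> fin k by simp
    ultimately show ?thesis by blast
  next
    case (2 i j)
    have q_ij: "q = (i, j)" using 2 by (simp add: leg_vertex_def)
    have "j = lam ! i"
    proof (rule ccontr)
      assume "j \<noteq> lam ! i"
      \<comment> \<open>An inner vertex of a leg already has two neighbours in the copy. With
        \<open>v\<close> as a third its degree would be at least 3, which is reserved for
        \<open>c\<close>.\<close>
      let ?x = "leg_vertex i (j - 1)" and ?y = "leg_vertex i (Suc j)"
      have mem: "?x \<in> ?V" "?y \<in> ?V"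
        using 2 \<open>j \<noteq> lam ! i\<close> by (auto intro!: leg_vertex_in_spider_verts)
      have "{q, ?x} \<in> spider_edges lam" "{q, ?y} \<in> spider_edges lam"
        using leg_edge_in_spider_edges[of i lam "j - 1"] leg_edge_in_spider_edges[of i lam j]
          2 \<open>j \<noteq> lam ! i\<close> by (auto simp: insert_commute)
      then have "{f q, f ?x} \<in> E" "{f q, f ?y} \<in> E" using adj q(1) mem by auto
      moreover have "?x \<noteq> ?y" by (auto simp: leg_vertex_def)
      then have "f ?x \<noteq> f ?y" using inj mem by (meson inj_onD)
      moreover have "f ?x \<noteq> v" "f ?y \<noteq> v" using v mem by blast+
      ultimately have "3 \<le> degree E (f q)"
        using degree_ge_3[OF simple_graph_finite_edges[OF E(1)], of "f q" "f ?x" "f ?y" v] q(2) by blast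
      moreover have "q \<noteq> (0, 0)" using q_ij 2 by simp
      then have "f q \<noteq> c" using inj q(1) f0 by (metis inj_onD insertI1 spider_verts_eq)
      ultimately show False using assms(3)[of "f q"] W q(1) by blast
    qed
    let ?p = "(i, Suc (lam ! i))" and ?lam = "lam[i := Suc (lam ! i)]"
    have "?p \<notin> ?V" by (auto simp: spider_verts_eq)
    moreover have "\<forall>k\<in>set ?lam. 0 < k" using pos set_update_subset_insert[of lam i "Suc (lam ! i)"] by auto
    moreover have "leg_edge i (lam ! i) = {q, ?p}"
      using 2 \<open>j = lam ! i\<close> by (simp add: leg_vertex_def)
    ultimately have "spider_embedding V E c ?lam (f(?p := v))"
      using 2 by (intro extend) (simp_all only: spider_verts_extend spider_edges_extend not_False_eq_True)
    moreover have "card (spider_verts ?lam) = Suc k"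
      unfolding spider_verts_extend[OF 2(2)] using \<open>?p \<notin> ?V\<close> fin k by simp
    ultimately show ?thesis by blast
  qed
qed

lemma spider_is_spider_T:
  assumes "spider V E"
  obtains lam where "is_spider_T lam V E"
proof -
  obtain c where c: "c \<in> V" "3 \<le> degree E c" "\<And>v. v \<in> V \<Longrightarrow> v \<noteq> c \<Longrightarrow> \<not> 3 \<le> degree E v"
    using assms unfolding spider_def by blast
  have tree: "tree_graph V E" and E: "simple_graph V E"
    using assms by (auto simp: spider_def tree_graph_def)
  have V: "finite V" using E by (simp add: simple_graph_def)
  then have "1 \<le> card V" using c(1) by (metis One_nat_def Suc_leI card_gt_0_iff empty_iff)
  from spider_embedding_exists[OF tree c(1,3) this le_refl]
  obtain lam f where f: "spider_embedding V E c lam f" and card: "card (spider_verts lam) = card V"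
    by auto
  let ?V = "spider_verts lam"
  have inj: "inj_on f ?V" and sub: "f ` ?V \<subseteq> V" and f0: "f (0, 0) = c" and pos: "\<forall>k\<in>set lam. 0 < k"
    and adj: "\<And>p q. p \<in> ?V \<Longrightarrow> q \<in> ?V \<Longrightarrow> {f p, f q} \<in> E \<longleftrightarrow> {p, q} \<in> spider_edges lam"
    using f by (auto simp: spider_embedding_def)
  have im: "f ` ?V = V" using card_subset_eq[OF V sub] card_image[OF inj] card by simp
  have iso: "graph_iso ?V (spider_edges lam) V E"
    unfolding graph_iso_def bij_betw_def using inj im adj by blast
  \<comment> \<open>Every edge at the centre is the first edge of a leg, so there are at least as
    many legs as the degree of \<open>c\<close>, hence at least 3.\<close>
  have "{e \<in> E. c \<in> e} \<subseteq> (\<lambda>i. {c, f (i, 1)}) ` {..<length lam}"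
  proof
    fix e assume e: "e \<in> {e \<in> E. c \<in> e}"
    then have "e \<subseteq> V" "card e = 2" using E unfolding simple_graph_def by blast+
    moreover have "c \<in> e" using e by simp
    ultimately obtain x where x: "e = {c, x}" "x \<in> V" by (auto simp: card_2_iff)
    then obtain q where q: "q \<in> ?V" "x = f q" using im by blast
    have "(0, 0) \<in> ?V" by (simp add: spider_verts_eq)
    then have "{(0, 0), q} \<in> spider_edges lam" using adj[of "(0, 0)" q] e x q f0 by simp
    then obtain i where "i < length lam" "q = (i, 1)"
      unfolding spider_edge_iff by (auto simp: leg_vertex_def split: if_splits)
    then show "e \<in> (\<lambda>i. {c, f (i, 1)}) ` {..<length lam}" using x q by blast
  qed
  then have "degree E c \<le> length lam"
    unfolding degree_def by (rule surj_card_le[of "{..<length lam}", simplified])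
  then have "3 \<le> length lam" using c(2) by simp
  define mu where "mu = rev (sort lam)"
  have mset: "mset mu = mset lam" by (simp add: mu_def)
  have "sum_list mu = card V - 1"
    using card card_spider_verts[of lam] mset by (metis diff_Suc_1 sum_mset_sum_list)
  moreover have "\<forall>k\<in>set mu. 0 < k" using pos by (simp add: mu_def)
  moreover have "sorted_wrt (\<ge>) mu" by (simp add: mu_def sorted_wrt_rev)
  moreover have "graph_iso V E (spider_verts mu) (spider_edges mu)"
    using graph_iso_trans[OF graph_iso_sym[OF iso] graph_iso_spider_permute[OF mset[symmetric]]] .
  moreover have "3 \<le> length mu" using \<open>3 \<le> length lam\<close> by (simp add: mu_def)
  ultimately have "is_spider_T mu V E" by (simp add: is_spider_T_def partition_of_def)
  then show ?thesis by (rule that)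
qed

section \<open>Conjugate partitions\<close>

text \<open>In a weakly decreasing list the indices of parts at least \<open>a\<close> form an
  initial segment, and \<open>leg_count\<close> is its length. This symmetry between rows and
  columns of the diagram drives all facts on conjugates below.\<close>

lemma leg_count_iff:
  assumes "sorted_wrt (\<ge>) lam" "i < length lam"
  shows "Suc i \<le> leg_count lam a \<longleftrightarrow> a \<le> lam ! i"
proof
  let ?A = "{i. i < length lam \<and> a \<le> lam ! i}"
  show "a \<le> lam ! i" if "Suc i \<le> leg_count lam a"
  proof (rule ccontr)
    assume "\<not> a \<le> lam ! i"
    then have "k < i" if "k \<in> ?A" for k
      using sorted_wrt_nth_less[OF assms(1), of i k] that by (cases k i rule: linorder_cases) auto
    then have "?A \<subseteq> {..<i}" by blast
    from card_mono[OF _ this] that show False by (simp add: leg_count_def)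
  qed
  show "Suc i \<le> leg_count lam a" if "a \<le> lam ! i"
  proof -
    have "k \<in> ?A" if "k \<le> i" for k
      using sorted_wrt_nth_less[OF assms(1), of k i] that \<open>a \<le> lam ! i\<close> assms(2) by (cases "k = i") auto
    then have "{..i} \<subseteq> ?A" by blast
    from card_mono[OF _ this] show ?thesis by (simp add: leg_count_def)
  qed
qed

lemma leg_count_antimono: "a \<le> b \<Longrightarrow> leg_count lam b \<le> leg_count lam a"
  unfolding leg_count_def by (rule card_mono) auto

lemma conj_partition_eq:
  assumes "sorted_wrt (\<ge>) lam" "lam \<noteq> []"
  shows "conj_partition lam = map (leg_count lam) [1..<Suc (lam ! 0)]"
proof -
  have "k \<le> lam ! 0" if "k \<in> set lam" for k
  proof -
    from that obtain i where i: "i < length lam" "k = lam ! i" by (auto simp: in_set_conv_nth)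
    then show ?thesis using sorted_wrt_nth_less[OF assms(1), of 0 i] by (cases "i = 0") auto
  qed
  then have "Max (insert 0 (set lam)) = lam ! 0"
    using assms(2) by (intro Max_eqI) auto
  then show ?thesis by (simp add: conj_partition_def leg_count_def del: upt_Suc)
qed

text \<open>The sum is preserved by counting the cells of the Young diagram once by columns and once
  by rows.\<close>

lemma partition_conj_partition:
  assumes "partition_of n lam" "lam \<noteq> []"
  shows "partition_of n (conj_partition lam)"
proof -
  have lam: "sorted_wrt (\<ge>) lam" "sum_list lam = n" using assms(1) by (auto simp: partition_of_def)
  note eq = conj_partition_eq[OF lam(1) assms(2)]
  have le: "lam ! i \<le> lam ! 0" if "i < length lam" for i
    using sorted_wrt_nth_less[OF lam(1), of 0 i] that by (cases "i = 0") auto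
  have "sorted_wrt (\<ge>) (conj_partition lam)"
    unfolding eq sorted_wrt_map
    by (rule sorted_wrt_mono_rel[OF _ sorted_upt]) (rule leg_count_antimono)
  moreover have "0 < k" if k: "k \<in> set (conj_partition lam)" for k
  proof -
    from k obtain a where "k = leg_count lam a" "a \<le> lam ! 0" unfolding eq by (auto simp del: upt_Suc)
    then show ?thesis using leg_count_iff[OF lam(1), of 0 a] assms(2) by simp
  qed
  moreover have "sum_list (conj_partition lam) = n"
  proof -
    have "sum_list (conj_partition lam)
        = (\<Sum>a\<in>{1..<Suc (lam ! 0)}. card {i \<in> {..<length lam}. a \<le> lam ! i})"
      unfolding eq by (simp add: sum_list_distinct_conv_sum_set leg_count_def del: upt_Suc)
    also have "\<dots> = (\<Sum>i<length lam. card {a \<in> {1..<Suc (lam ! 0)}. a \<le> lam ! i})"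
      unfolding card_eq_sum by (rule sum.swap_restrict) auto
    also have "\<dots> = (\<Sum>i<length lam. lam ! i)"
    proof (rule sum.cong[OF refl])
      fix i assume "i \<in> {..<length lam}"
      then have "{a \<in> {1..<Suc (lam ! 0)}. a \<le> lam ! i} = {1..lam ! i}" using le[of i] by auto
      then show "card {a \<in> {1..<Suc (lam ! 0)}. a \<le> lam ! i} = lam ! i" by simp
    qed
    also have "\<dots> = n" using lam(2) by (simp add: sum_list_sum_nth atLeast0LessThan)
    finally show ?thesis .
  qed
  ultimately show ?thesis by (simp add: partition_of_def)
qed

lemma conj_partition_conj_partition:
  assumes "partition_of n lam" "lam \<noteq> []"
  shows "conj_partition (conj_partition lam) = lam"
proof -
  define mu where "mu = conj_partition lam"
  define L where "L = lam ! 0"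
  have lam: "sorted_wrt (\<ge>) lam" "\<forall>k\<in>set lam. 0 < k" using assms(1) by (auto simp: partition_of_def)
  have mu: "mu = map (leg_count lam) [1..<Suc L]"
    unfolding mu_def L_def by (rule conj_partition_eq[OF lam(1) assms(2)])
  have le: "lam ! i \<le> L" if "i < length lam" for i
    using sorted_wrt_nth_less[OF lam(1), of 0 i] that unfolding L_def by (cases "i = 0") auto
  have len: "length mu = L" by (simp add: mu del: upt_Suc)
  have nth: "mu ! j = leg_count lam (Suc j)" if "j < L" for j
    using that by (simp add: mu nth_append del: upt_Suc)
  have "1 \<le> L" using lam(2) assms(2) unfolding L_def by (simp add: Suc_leI)
  have "{i. i < length lam \<and> 1 \<le> lam ! i} = {..<length lam}" using lam(2) by (auto simp: Suc_le_eq)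
  then have "leg_count lam 1 = length lam" by (simp add: leg_count_def)
  then have "mu ! 0 = length lam" using nth[of 0] \<open>1 \<le> L\<close> by simp
  moreover have "sorted_wrt (\<ge>) mu"
    using partition_conj_partition[OF assms] by (simp add: mu_def partition_of_def)
  moreover have "mu \<noteq> []" using len \<open>1 \<le> L\<close> by auto
  ultimately have conj: "conj_partition mu = map (leg_count mu) [1..<Suc (length lam)]"
    using conj_partition_eq by metis
  have "leg_count mu (Suc i) = lam ! i" if i: "i < length lam" for i
  proof -
    \<comment> \<open>Index \<open>j\<close> of the list \<open>mu\<close> holds part number
      \<open>Suc j\<close>, so \<open>leg_count_iff\<close> turns the condition on
      \<open>mu ! j\<close> into \<open>Suc j \<le> lam ! i\<close>.\<close>
    have "{j. j < length mu \<and> Suc i \<le> mu ! j} = {..<lam ! i}"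
      using le[OF i] leg_count_iff[OF lam(1) i] nth len by (auto simp: Suc_le_eq)
    then show ?thesis by (simp add: leg_count_def)
  qed
  then have "conj_partition mu = lam"
    unfolding conj by (intro nth_equalityI) (simp_all del: upt_Suc)
  then show ?thesis by (simp add: mu_def)
qed

section \<open>Reading the partition off the coefficients\<close>

lemma concat_expand_no_two:
  assumes "\<forall>x\<in>set xs. x \<noteq> (2::rat)"
  shows "concat (map (\<lambda>x. if x = 2 then [1, 1] else [x]) xs) = xs"
  using assms by (induction xs) auto

lemma concat_expand_all_two:
  assumes "\<forall>x\<in>set xs. x = (2::rat)"
  shows "concat (map (\<lambda>x. if x = 2 then [1, 1] else [x]) xs) = replicate (2 * length xs) 1"
  using assms by (induction xs) auto

theorem theorem3p2:
  fixes V :: "'a set" and E :: "'a set set" and n m :: nat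
    and d :: "nat \<Rightarrow> rat" and dT :: "rat list"
    and case1 :: bool and case2 :: "nat \<Rightarrow> bool"
  assumes "spider V E"
    and "card V = n"
    and "m = n div 2"
    and "\<And>a. 1 \<le> a \<Longrightarrow> a \<le> m \<Longrightarrow> d a = \<bar>power_sum_coeff V E [n - a, a]\<bar>"
    and "dT = map d [1..<Suc m]"
    and "case1 \<longleftrightarrow> (\<forall>a. 1 \<le> a \<and> a < m \<longrightarrow> d a \<ge> d (Suc a)) \<and> d m \<ge> 0"
    and "\<And>t. case2 t \<longleftrightarrow> 1 \<le> t \<and> t \<le> m \<and>
           (\<forall>a. 1 \<le> a \<and> a < t \<longrightarrow> d a \<ge> d (Suc a)) \<and> d t = 1 \<and>
           (\<forall>a. t < a \<and> a < m \<longrightarrow> d a = 2) \<and> d m \<in> {1, 2}"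
  shows "(case1 \<or> (\<exists>t. case2 t)) \<and>
    (case1 \<longrightarrow>
       (\<exists>\<mu>. partition_of (n - 1) \<mu> \<and>
            map of_nat \<mu> = filter (\<lambda>x. x \<noteq> 0) dT \<and>
            is_spider_T (conj_partition \<mu>) V E)) \<and>
    (\<forall>t. case2 t \<longrightarrow>
       (\<exists>\<mu>. partition_of (n - 1) \<mu> \<and>
            map of_nat \<mu> = take t dT @ concat (map (\<lambda>x. if x = 2 then [1, 1] else [x]) (drop t dT)) \<and>
            is_spider_T (conj_partition \<mu>) V E))"
proof -
  obtain lam where T: "is_spider_T lam V E" using spider_is_spider_T[OF assms(1)] .
  then have part: "partition_of (n - 1) lam" and len: "3 \<le> length lam"
    and iso: "graph_iso V E (spider_verts lam) (spider_edges lam)"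
    using assms(2) by (auto simp: is_spider_T_def)
  have simple: "simple_graph V E" using assms(1) by (simp add: spider_def tree_graph_def)
  have sorted: "sorted_wrt (\<ge>) lam" and pos: "\<forall>k\<in>set lam. 0 < k" using part by (auto simp: partition_of_def)
  have n: "n = Suc (sum_list lam)"
    using iso assms(2) card_spider_verts[of lam] by (auto simp: graph_iso_def dest: bij_betw_same_card)
  define L where "L = lam ! 0"
  let ?lc = "leg_count lam"
  let ?\<mu> = "conj_partition lam"
  let ?g = "\<lambda>x::rat. if x = 2 then [1, 1] else [x]"
  have nonempty: "lam \<noteq> []" using len by auto
  have \<mu>: "?\<mu> = map ?lc [1..<Suc L]" unfolding L_def by (rule conj_partition_eq[OF sorted nonempty])
  have part_\<mu>: "partition_of (n - 1) ?\<mu>" using partition_conj_partition[OF part nonempty] .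
  have T_\<mu>: "is_spider_T (conj_partition ?\<mu>) V E"
    using T conj_partition_conj_partition[OF part nonempty] by simp
  have d: "d a = of_nat (?lc a + (if 2 * a = n then 0 else ?lc (n - a)))" if "1 \<le> a" "a \<le> m" for a
    using abs_power_sum_coeff_spider[OF n, of a] assms(3,4) that
      power_sum_coeff_iso[OF simple simple_graph_spider iso] by simp
  have lc_pos: "1 \<le> ?lc a \<longleftrightarrow> a \<le> L" for a
    using leg_count_iff[OF sorted, of 0 a] nonempty by (simp add: L_def)
  have lc_zero: "?lc a = 0" if "L < a" for a using lc_pos[of a] that by simp
  \<comment> \<open>Three nonempty legs: this keeps \<open>L\<close> at distance 3 from
    \<open>n\<close>, and the third leg makes the second strictly shorter than all legs but the
    longest together.\<close>
  have "lam ! 0 + (lam ! 1 + lam ! 2) \<le> sum_list lam" "0 < lam ! 2" "0 < lam ! 1" "0 < L"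
    using len pos unfolding L_def by (auto simp: numeral_3_eq_3 Suc_le_length_iff)
  then have bound: "L + lam ! 1 + 2 \<le> n" "L + 3 \<le> n" "0 < L" by (auto simp: n L_def)
  then have "2 \<le> m" using assms(3) by simp
  show ?thesis
  proof (cases "L \<le> m")
    case True
    have dlc: "d a = of_nat (?lc a)" if "1 \<le> a" "a \<le> m" for a
    proof (cases "2 * a = n")
      case False
      \<comment> \<open>Here \<open>n - a\<close> exceeds \<open>m\<close>, so no leg reaches the
        complementary length.\<close>
      then have "L < n - a" using True that assms(3) by linarith
      then show ?thesis using d[OF that] lc_zero by simp
    qed (simp add: d[OF that])
    have mono: "d b \<le> d a" if "1 \<le> a" "a \<le> b" "b \<le> m" for a b
      using that leg_count_antimono[of a b lam] by (simp add: dlc)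
    have case1 unfolding assms(6) using mono[of _ "Suc _"] dlc[of m] \<open>2 \<le> m\<close> by simp
    have "[1..<Suc m] = [1..<Suc L] @ [Suc L..<Suc m]"
      using upt_add_eq_append[of 1 "Suc L" "m - L"] True by simp
    then have "filter (\<lambda>x. x \<noteq> 0) dT
        = filter (\<lambda>x. x \<noteq> 0) (map d [1..<Suc L]) @ filter (\<lambda>x. x \<noteq> 0) (map d [Suc L..<Suc m])"
      unfolding assms(5) by (simp only: map_append filter_append)
    also have "filter (\<lambda>x. x \<noteq> 0) (map d [1..<Suc L]) = map d [1..<Suc L]"
      using lc_pos[unfolded One_nat_def Suc_le_eq] dlc True by (intro filter_True) (auto simp del: upt_Suc)
    also have "filter (\<lambda>x. x \<noteq> 0) (map d [Suc L..<Suc m]) = []"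
      using lc_zero dlc by (intro filter_False) (auto simp del: upt_Suc)
    also have "map d [1..<Suc L] = map of_nat ?\<mu>"
      unfolding \<mu> using dlc True by (auto simp del: upt_Suc)
    finally have filter: "map of_nat ?\<mu> = filter (\<lambda>x. x \<noteq> 0) dT" by simp
    \<comment> \<open>Case (2) may hold besides case (1). By monotonicity all entries after place
      \<open>t\<close> are at most 1, so nothing is expanded, and \<open>d m\<close> being at least
      1 leaves no zero to drop.\<close>
    have "map of_nat ?\<mu> = take t dT @ concat (map ?g (drop t dT))" if "case2 t" for t
    proof -
      from that have t: "1 \<le> t" "t \<le> m" "d t = 1" "1 \<le> d m" unfolding assms(7) by auto
      have "d a \<noteq> 2" if "Suc t \<le> a" "a \<le> m" for a
        using mono[of t a] that t by auto
      then have "\<forall>x\<in>set (drop t dT). x \<noteq> 2"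
        unfolding assms(5) by (auto simp: drop_map drop_upt simp del: upt_Suc)
      then have "take t dT @ concat (map ?g (drop t dT)) = dT"
        by (simp add: concat_expand_no_two)
      moreover have "filter (\<lambda>x. x \<noteq> 0) dT = dT"
        unfolding assms(5) using mono[of _ m] t(4) by (intro filter_True) (force simp del: upt_Suc)
      ultimately show ?thesis using filter by simp
    qed
    with \<open>case1\<close> filter part_\<mu> T_\<mu> show ?thesis by blast
  next
    case False
    \<comment> \<open>The total length of all legs but the longest; it will be the only possible
      \<open>t\<close>.\<close>
    define s where "s = n - 1 - L"
    have s: "1 \<le> s" "Suc s \<le> m" "L = n - 1 - s" "s < L" "lam ! 1 < s"
      using bound False assms(3) unfolding s_def by linarith+
    \<comment> \<open>Equality would force \<open>L = m\<close>. So place \<open>Suc s\<close>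
      carries a genuine 2, the ascent that refutes case (1).\<close>
    have s_not_half: "2 * Suc s \<noteq> n" using s(3,4) False assms(3) by presburger
    have lc1: "?lc a = 1" if "s \<le> a" "a \<le> L" for a
      using leg_count_iff[OF sorted, of 1 a] lc_pos[of a] that s len by auto
    have d_small: "d a = of_nat (?lc a)" if "1 \<le> a" "a \<le> s" for a
    proof -
      have "a \<le> m" "L < n - a" using s that bound by linarith+
      then show ?thesis using d[of a] lc_zero[of "n - a"] that by simp
    qed
    have d_large: "d a = (if 2 * a = n then 1 else 2)" if "s < a" "a \<le> m" for a
    proof -
      \<comment> \<open>Both \<open>a\<close> and \<open>n - a\<close> lie in the range where
        exactly the longest leg is counted.\<close>
      have "s \<le> a" "a \<le> L" "s \<le> n - a" "n - a \<le> L" "1 \<le> a" using s that False assms(3) by linarith+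
      then show ?thesis using d[of a] lc1[of a] lc1[of "n - a"] that by simp
    qed
    have ds: "d s = 1" using d_small[of s] lc1[of s] s by simp
    have d2: "d (Suc s) = 2" using d_large[of "Suc s"] s s_not_half by simp
    have "\<not> case1"
    proof
      assume case1
      then have "d (Suc s) \<le> d s" using s unfolding assms(6) by simp
      then show False by (simp add: ds d2)
    qed
    have "case2 s"
      unfolding assms(7)
    proof (intro conjI allI impI)
      show "d (Suc a) \<le> d a" if "1 \<le> a \<and> a < s" for a
        using that leg_count_antimono[of a "Suc a" lam] by (simp add: d_small)
      show "d a = 2" if "s < a \<and> a < m" for a
        using that assms(3) d_large[of a] by auto
      show "d m \<in> {1, 2}" using d_large[of m] s by auto
    qed (use s ds in auto)
    \<comment> \<open>The conclusion concerns every admissible \<open>t\<close>. A smaller one would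
      require \<open>d s = 2\<close>; a larger one would require a descent from place
      \<open>s\<close> to place \<open>Suc s\<close>.\<close>
    have unique: "t = s" if "case2 t" for t
    proof (rule ccontr)
      assume "t \<noteq> s"
      then consider "t < s" | "s < t" by linarith
      then show False
      proof cases
        case 1
        then have "d s = 2" using that s unfolding assms(7) by simp
        then show False by (simp add: ds)
      next
        case 2
        then have "d (Suc s) \<le> d s" using that s unfolding assms(7) by simp
        then show False by (simp add: ds d2)
      qed
    qed
    \<comment> \<open>For even \<open>n\<close> there are \<open>m - Suc s\<close> twos and a final
      1, for odd \<open>n\<close> there are \<open>m - s\<close> twos. In both cases the entries add
      up to \<open>L - s\<close>, the number of ones after place \<open>s\<close> in the conjugate
      partition.\<close>
    have tail: "concat (map ?g (drop s dT)) = replicate (L - s) 1"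
    proof -
      have drop: "drop s dT = map d [Suc s..<Suc m]"
        unfolding assms(5) by (simp add: drop_map drop_upt del: upt_Suc)
      show ?thesis
      proof (cases "even n")
        case True
        then have nm: "n = 2 * m" using assms(3) by simp
        have "\<forall>x\<in>set (map d [Suc s..<m]). x = 2" using d_large nm by auto
        note twos = concat_expand_all_two[OF this]
        have "d m = 1" using d_large[of m] s nm by simp
        have "[Suc s..<Suc m] = [Suc s..<m] @ [m]" using s by simp
        then have "concat (map ?g (drop s dT)) = concat (map ?g (map d [Suc s..<m])) @ ?g (d m)"
          unfolding drop by simp
        also have "\<dots> = replicate (Suc (2 * (m - Suc s))) 1"
          unfolding twos by (simp add: \<open>d m = 1\<close> replicate_append_same)
        also have "Suc (2 * (m - Suc s)) = L - s" using s nm by linarith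
        finally show ?thesis .
      next
        case odd: False
        then have nm: "n = 2 * m + 1" using assms(3) by presburger
        have "\<forall>x\<in>set (map d [Suc s..<Suc m]). x = 2"
          using d_large nm by (auto simp del: upt_Suc)
        from concat_expand_all_two[OF this] show ?thesis
          unfolding drop using s nm by (simp del: upt_Suc)
      qed
    qed
    have "map of_nat ?\<mu> = take s dT @ concat (map ?g (drop s dT))"
    proof -
      have "[1..<Suc L] = [1..<Suc s] @ [Suc s..<Suc L]"
        using upt_add_eq_append[of 1 "Suc s" "L - s"] s by simp
      then have "map of_nat ?\<mu> = map (\<lambda>a. of_nat (?lc a)) [1..<Suc s] @ map (\<lambda>a. of_nat (?lc a)) [Suc s..<Suc L]"
        unfolding \<mu> by (simp only: map_append map_map comp_def)
      also have "map (\<lambda>a. of_nat (?lc a)) [1..<Suc s] = map d [1..<Suc s]"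
        using d_small by (auto simp del: upt_Suc)
      also have "\<dots> = take s dT"
        unfolding assms(5) using s by (simp add: take_map take_upt del: upt_Suc)
      also have "map (\<lambda>a. of_nat (?lc a)) [Suc s..<Suc L] = map (\<lambda>_. 1) [Suc s..<Suc L]"
        using lc1 by (auto simp del: upt_Suc)
      also have "\<dots> = replicate (L - s) 1" by (simp add: map_replicate_const del: upt_Suc)
      finally show ?thesis unfolding tail .
    qed
    with \<open>\<not> case1\<close> \<open>case2 s\<close> unique part_\<mu> T_\<mu> show ?thesis by blast
  qed
qed

end
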